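(* Let $A\in\mathbb{R}^{n\times n}$ be stable, and let $\sigma,\rho\in(0,1)$ and $\alpha>0$. Let $\{p^{(k)}\}_{k\ge 0}$ be a sequence generated by the projected gradient method with tolerance $\varepsilon=0$ and initial point $p^{(0)}=(1/n,\dots,1/n)$ described in the context. Then $\lim_{k\to\infty} p^{(k)} = p^*$, where $p^*$ is the (unique) optimal solution of the problem of minimizing $f(p) = -\log\det W_{\rm con}(p)$ subject to $p\in\mathcal{F}=X\cap\Delta$.
   Context: A real square matrix $A$ is called stable if all of its eigenvalues have negative real part. For stable $A\in\mathbb{R}^{n\times n}$ and $i=1,\dots,n$ put $W_i := \int_0^\infty \exp(At)\, e_i e_i^\top \exp(A^\top t)\, dt$, where $e_i\in\mathbb{R}^n$ is the $i$-th standard basis vector. For $p=(p_1,\dots,p_n)\in\mathbb{R}^n$ put $W_{\rm con}(p) := \sum_{i=1}^n p_i W_i$. Let $X := \{p\in\mathbb{R}^n \mid W_{\rm con}(p)\succ O\}$ (positive definite), $\Delta := \{p\in\mathbb{R}^n \mid \sum_{i=1}^n p_i = 1,\ p_i\ge 0 \ (i=1,\dots,n)\}$, and $\mathcal{F} := X\cap\Delta$. The function $f$ is defined on $X$ by $f(p) := -\log\det W_{\rm con}(p)$; its gradient on $X$ is $(\nabla f(p))_i = -\operatorname{tr}(W_{\rm con}(p)^{-1}W_i)$. Let $\Pi_\Delta(q) := \operatorname{argmin}_{p\in\Delta}\|p-q\|^2$ be the Euclidean projection onto $\Delta$. Projected gradient method. Start from $p^{(0)}=(1/n,\dots,1/n)\in\mathcal{F}$.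 For $k=0,1,2,\dots$: set $q^{(k)} := p^{(k)}-\alpha^{(k)}\nabla f(p^{(k)})$ and $p^{(k+1)} := \Pi_\Delta(q^{(k)})$; if $\|p^{(k)}-p^{(k+1)}\|\le\varepsilon$, stop and return $p^{(k+1)}$ (if the method stops, the sequence is regarded as constant from then on). The step size $\alpha^{(k)}$ is given by the Armijo rule along the projection arc: at each iteration $k$, starting with trial value equal to the fixed input $\alpha>0$, compute $\tilde p^{(k)} := \Pi_\Delta(p^{(k)}-\alpha\nabla f(p^{(k)}))$; if $f(\tilde p^{(k)})\le f(p^{(k)})+\sigma\,\nabla f(p^{(k)})^\top(\tilde p^{(k)}-p^{(k)})$, set $\alpha^{(k)}:=\alpha$ (the current trial value); otherwise replace the trial value $\alpha$ by $\rho\alpha$ and repeat. The inequality is regarded as not satisfied when $\tilde p^{(k)}\notin X$, since $f$ is not defined there. *)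

theory Defs
  imports "HOL-Analysis.Analysis"
begin

definition stable_matrix :: "real^'n^'n \<Rightarrow> bool" where
  "stable_matrix A \<longleftrightarrow>
     (\<forall>(z::complex) (v::complex^'n). v \<noteq> 0 \<and> map_matrix complex_of_real A *v v = z *s v \<longrightarrow> Re z < 0)"

text \<open>The multiplication \<open>*\<close> of type \<^typ>\<open>real^'n^'n\<close>, hence also \<open>^\<close>, acts
  componentwise; matrix powers are therefore iterates of \<open>**\<close>.\<close>

definition mat_exp :: "real^'n^'n \<Rightarrow> real^'n^'n" where
  "mat_exp M = (\<Sum>k. (1 / fact k) *\<^sub>R (((**) M ^^ k) (mat 1)))"

definition outer_prod :: "real^'n \<Rightarrow> real^'n \<Rightarrow> real^'n^'n" where
  "outer_prod v w = (\<chi> i j. v $ i * w $ j)"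

definition pos_def :: "real^'n^'n \<Rightarrow> bool" where
  "pos_def M \<longleftrightarrow> transpose M = M \<and> (\<forall>x. x \<noteq> 0 \<longrightarrow> 0 < x \<bullet> (M *v x))"

definition gramian :: "real^'n^'n \<Rightarrow> 'n \<Rightarrow> real^'n^'n" where
  "gramian A i = integral {0..}
     (\<lambda>t. mat_exp (t *\<^sub>R A) ** outer_prod (axis i 1) (axis i 1) ** mat_exp (t *\<^sub>R transpose A))"

definition W_con :: "real^'n^'n \<Rightarrow> real^'n \<Rightarrow> real^'n^'n" where
  "W_con A p = (\<Sum>i\<in>UNIV. p $ i *\<^sub>R gramian A i)"

definition X_set :: "real^'n^'n \<Rightarrow> (real^'n) set" where
  "X_set A = {p. pos_def (W_con A p)}"

definition std_simplex :: "(real^'n) set" where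
  "std_simplex = {p. (\<Sum>i\<in>UNIV. p $ i) = 1 \<and> (\<forall>i. 0 \<le> p $ i)}"

definition feasible_set :: "real^'n^'n \<Rightarrow> (real^'n) set" where
  "feasible_set A = X_set A \<inter> std_simplex"

text \<open>The objective is meaningful on \<open>X_set A\<close> only; its values elsewhere are junk.\<close>

definition objective :: "real^'n^'n \<Rightarrow> real^'n \<Rightarrow> real" where
  "objective A p = - ln (det (W_con A p))"

definition gradient :: "('a::real_inner \<Rightarrow> real) \<Rightarrow> 'a \<Rightarrow> 'a" where
  "gradient f x = (THE D. GDERIV f x :> D)"

definition trial_point :: "real^'n^'n \<Rightarrow> real^'n \<Rightarrow> real \<Rightarrow> real^'n" where
  "trial_point A p a = closest_point std_simplex (p - a *\<^sub>R gradient (objective A) p)"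

definition armijo_cond :: "real^'n^'n \<Rightarrow> real \<Rightarrow> real^'n \<Rightarrow> real \<Rightarrow> bool" where
  "armijo_cond A \<sigma> p a \<longleftrightarrow>
     trial_point A p a \<in> X_set A \<and>
     objective A (trial_point A p a)
       \<le> objective A p + \<sigma> * (gradient (objective A) p \<bullet> (trial_point A p a - p))"

text \<open>\<open>a\<close> is the first of the trial values \<open>\<alpha>, \<rho> * \<alpha>, \<rho>\<^sup>2 * \<alpha>, \<dots>\<close> that is accepted.\<close>

definition armijo_step :: "real^'n^'n \<Rightarrow> real \<Rightarrow> real \<Rightarrow> real \<Rightarrow> real^'n \<Rightarrow> real \<Rightarrow> bool" where
  "armijo_step A \<sigma> \<rho> \<alpha> p a \<longleftrightarrow>
     (\<exists>m. a = \<rho> ^ m * \<alpha> \<and> armijo_cond A \<sigma> p a \<and> (\<forall>j<m. \<not> armijo_cond A \<sigma> p (\<rho> ^ j * \<alpha>)))"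

text \<open>Once some step has length at most \<open>\<epsilon>\<close>, the method has stopped and the sequence stays
  constant.\<close>

definition pgm_sequence ::
    "real^'n^'n \<Rightarrow> real \<Rightarrow> real \<Rightarrow> real \<Rightarrow> real \<Rightarrow> (nat \<Rightarrow> real^'n) \<Rightarrow> bool" where
  "pgm_sequence A \<sigma> \<rho> \<alpha> \<epsilon> p \<longleftrightarrow>
     p 0 = (\<chi> i. 1 / real CARD('n)) \<and>
     (\<forall>k. if \<exists>j<k. norm (p j - p (Suc j)) \<le> \<epsilon>
          then p (Suc k) = p k
          else \<exists>a. armijo_step A \<sigma> \<rho> \<alpha> (p k) a \<and> p (Suc k) = trial_point A (p k) a)"

end

theory Submission
  imports Defs "HOL-Computational_Algebra.Fundamental_Theorem_Algebra"
begin

text \<open>The Gramians \<open>W\<^sub>i\<close> exist because \<open>exp (A t)\<close> decays exponentially: a polynomial annihilates \<open>A\<close>, and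
  peeling off its roots one by one reduces the system to scalar equations \<open>v' = z v + w\<close> with \<open>Re z < 0\<close>
  and \<open>w\<close> decaying. Integrating \<open>F' = A F + F A\<^sup>T\<close> yields the Lyapunov equation
  \<open>A W(p) + W(p) A\<^sup>T = - diag p\<close>, so \<open>W\<close> is injective and the initial point is feasible. Together with the
  strict concavity of \<open>ln det\<close>, injectivity makes \<open>f\<close> strictly convex; on the simplex \<open>W(p)\<close> is positive
  semidefinite, so feasibility there means \<open>det W(p) > 0\<close> and the sublevel set of the initial point is
  compact.

  For the convergence, the Armijo rule makes the steps \<open>d\<^sub>k\<close> tend to \<open>0\<close>. At each iteration consider
  either the accepted step size (if it is \<open>\<alpha>\<close>) or the last rejected one, \<open>b\<^sub>k\<close>, with projected point \<open>z\<^sub>k\<close>.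
  Since the length of a projected step divided by the step size is nonincreasing in the step size,
  \<open>\<bar>z\<^sub>k - p\<^sub>k\<bar> \<le> \<bar>d\<^sub>k\<bar> / \<rho>\<close>, and rejection forces \<open>\<bar>z\<^sub>k - p\<^sub>k\<bar> / b\<^sub>k \<rightarrow> 0\<close> by uniform continuity of the gradient.
  By convexity this residual bounds \<open>f(p\<^sub>k) - f(p\<^sup>*)\<close>.\<close>

section \<open>Exponentially decaying functions\<close>

definition exp_decaying :: "(real \<Rightarrow> 'a::real_normed_vector) \<Rightarrow> bool" where
  "exp_decaying v \<longleftrightarrow> (\<exists>C c. 0 < c \<and> (\<forall>t\<ge>0. norm (v t) \<le> C * exp (- c * t)))"

lemma exp_decaying_add:
  assumes "exp_decaying v" "exp_decaying w"
  shows "exp_decaying (\<lambda>t. v t + w t)"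
proof -
  obtain C c where v: "0 < c" "\<And>t. 0 \<le> t \<Longrightarrow> norm (v t) \<le> C * exp (- c * t)"
    using assms(1) unfolding exp_decaying_def by blast
  obtain D d where w: "0 < d" "\<And>t. 0 \<le> t \<Longrightarrow> norm (w t) \<le> D * exp (- d * t)"
    using assms(2) unfolding exp_decaying_def by blast
  have "0 \<le> C" "0 \<le> D"
    using order_trans[OF norm_ge_zero v(2)[of 0]] order_trans[OF norm_ge_zero w(2)[of 0]] by simp_all
  have "norm (v t + w t) \<le> (C + D) * exp (- min c d * t)" if "0 \<le> t" for t
  proof -
    have "C * exp (- c * t) \<le> C * exp (- min c d * t)" "D * exp (- d * t) \<le> D * exp (- min c d * t)"
      using \<open>0 \<le> C\<close> \<open>0 \<le> D\<close> that by (auto intro!: mult_left_mono mult_right_mono)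
    then show ?thesis
      using v(2)[OF that] w(2)[OF that] norm_triangle_ineq[of "v t" "w t"]
      by (simp add: distrib_right)
  qed
  then show ?thesis
    unfolding exp_decaying_def using v(1) w(1) by (intro exI[of _ "C + D"] exI[of _ "min c d"]) auto
qed

lemma exp_decaying_mult:
  fixes v w :: "real \<Rightarrow> 'a::real_normed_algebra"
  assumes "exp_decaying v" "exp_decaying w"
  shows "exp_decaying (\<lambda>t. v t * w t)"
proof -
  obtain C c where v: "0 < c" "\<And>t. 0 \<le> t \<Longrightarrow> norm (v t) \<le> C * exp (- c * t)"
    using assms(1) unfolding exp_decaying_def by blast
  obtain D d where w: "0 < d" "\<And>t. 0 \<le> t \<Longrightarrow> norm (w t) \<le> D * exp (- d * t)"
    using assms(2) unfolding exp_decaying_def by blast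
  have "norm (v t * w t) \<le> (C * D) * exp (- (c + d) * t)" if "0 \<le> t" for t
  proof -
    have "norm (v t * w t) \<le> norm (v t) * norm (w t)"
      by (rule norm_mult_ineq)
    also have "\<dots> \<le> (C * exp (- c * t)) * (D * exp (- d * t))"
      using v(2)[OF that] w(2)[OF that] by (intro mult_mono) (auto intro: order_trans[OF norm_ge_zero])
    also have "\<dots> = (C * D) * exp (- (c + d) * t)"
      by (simp add: exp_add algebra_simps flip: exp_add)
    finally show ?thesis .
  qed
  then show ?thesis
    unfolding exp_decaying_def using v(1) w(1) by (intro exI[of _ "C * D"] exI[of _ "c + d"]) auto
qed

lemma exp_decaying_cmult:
  fixes v :: "real \<Rightarrow> 'a::real_normed_algebra"
  assumes "exp_decaying v"
  shows "exp_decaying (\<lambda>t. a * v t)"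
proof -
  obtain C c where v: "0 < c" "\<And>t. 0 \<le> t \<Longrightarrow> norm (v t) \<le> C * exp (- c * t)"
    using assms(1) unfolding exp_decaying_def by blast
  have "norm (a * v t) \<le> (norm a * C) * exp (- c * t)" if "0 \<le> t" for t
    using order_trans[OF norm_mult_ineq mult_left_mono[OF v(2)[OF that] norm_ge_zero[of a]]]
    by (simp add: mult.assoc)
  then show ?thesis
    unfolding exp_decaying_def using v(1) by blast
qed

lemma exp_decaying_zero: "exp_decaying (\<lambda>t. 0)"
  unfolding exp_decaying_def by (intro exI[of _ 0] exI[of _ 1]) auto

lemma exp_decaying_sum:
  assumes "\<And>i. i \<in> I \<Longrightarrow> exp_decaying (v i)"
  shows "exp_decaying (\<lambda>t. \<Sum>i\<in>I. v i t)"
proof (cases "finite I")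
  case True
  from this assms show ?thesis
    by (induction I rule: finite_induct) (auto intro: exp_decaying_zero exp_decaying_add)
qed (simp add: exp_decaying_zero)

lemma exp_decaying_tendsto_0:
  assumes "exp_decaying v"
  shows "(v \<longlongrightarrow> 0) at_top"
proof -
  obtain C c where v: "0 < c" "\<And>t. 0 \<le> t \<Longrightarrow> norm (v t) \<le> C * exp (- c * t)"
    using assms(1) unfolding exp_decaying_def by blast
  have "((\<lambda>t. C * exp (- c * t)) \<longlongrightarrow> C * 0) at_top"
    using v(1) by (intro tendsto_intros filterlim_compose[OF exp_at_bot] filterlim_tendsto_neg_mult_at_bot[OF tendsto_const])
      (auto simp: filterlim_ident)
  then have "((\<lambda>t. C * exp (- c * t)) \<longlongrightarrow> 0) at_top"
    by simp
  then show ?thesis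
    by (rule Lim_null_comparison[rotated]) (use v(2) in \<open>auto simp: eventually_at_top_linorder\<close>)
qed

lemma exp_decaying_absolutely_integrable:
  fixes v :: "real \<Rightarrow> 'a::euclidean_space"
  assumes "exp_decaying v" "continuous_on {0..} v"
  shows "v absolutely_integrable_on {0..}"
proof -
  obtain C c where v: "0 < c" "\<And>t. 0 \<le> t \<Longrightarrow> norm (v t) \<le> C * exp (- c * t)"
    using assms(1) unfolding exp_decaying_def by blast
  show ?thesis
  proof (rule measurable_bounded_by_integrable_imp_absolutely_integrable)
    show "v \<in> borel_measurable (lebesgue_on {0..})"
      by (intro continuous_imp_measurable_on_sets_lebesgue assms) auto
    show "(\<lambda>t. C * exp (- c * t)) integrable_on {0..}"
      using integrable_on_mult_right[OF integrable_on_exp_minus_to_infinity[OF v(1), of 0], of C] by simp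
  qed (use v in auto)
qed

text \<open>The fundamental theorem of calculus on \<open>{0..b}\<close>; absolute integrability
  lets \<open>b\<close> tend to infinity, where \<open>F b\<close> vanishes.\<close>

lemma has_integral_derivative_exp_decaying:
  fixes F :: "real \<Rightarrow> 'a::euclidean_space"
  assumes "exp_decaying F" "exp_decaying f" "continuous_on {0..} f"
    and deriv: "\<And>t. (F has_vector_derivative f t) (at t)"
  shows "(f has_integral - F 0) {0..}"
proof -
  have f: "f absolutely_integrable_on {0..}"
    by (intro exp_decaying_absolutely_integrable assms)
  have part: "(LINT t:{0..b}|lebesgue. f t) = F b - F 0" if "0 \<le> b" for b
  proof -
    have "(f has_integral F b - F 0) {0..b}"
      using that deriv by (intro fundamental_theorem_of_calculus)
        (auto intro: has_vector_derivative_at_within)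
    moreover have "f absolutely_integrable_on {0..b}"
      by (rule set_integrable_subset[OF f]) auto
    ultimately show ?thesis
      using set_lebesgue_integral_eq_integral(2) by (metis integral_unique)
  qed
  have lim: "((\<lambda>b. LINT t:{0..b}|lebesgue. f t) \<longlongrightarrow> (LINT t:{0..}|lebesgue. f t)) at_top"
    by (intro tendsto_set_lebesgue_integral_at_top f) auto
  have "((\<lambda>b. F b - F 0) \<longlongrightarrow> 0 - F 0) at_top"
    by (intro tendsto_intros exp_decaying_tendsto_0 assms)
  then have "((\<lambda>b. F b - F 0) \<longlongrightarrow> - F 0) at_top"
    by simp
  then have "((\<lambda>b. LINT t:{0..b}|lebesgue. f t) \<longlongrightarrow> - F 0) at_top"
    by (rule Lim_transform_eventually)
      (auto simp: eventually_at_top_linorder part intro!: exI[of _ 0])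
  then have "(LINT t:{0..}|lebesgue. f t) = - F 0"
    using tendsto_unique[OF _ lim] by force
  then show ?thesis
    using set_lebesgue_integral_eq_integral[OF f] by (metis has_integral_integral)
qed

text \<open>The integrating factor \<open>exp (- z t)\<close> leaves a function \<open>h\<close>
  whose derivative is at most \<open>C exp (r t)\<close> in norm; comparison with
  \<open>C / r * exp (r t)\<close> bounds \<open>h\<close>, and multiplying back gives the rate
  \<open>d\<close>.\<close>

lemma exp_decaying_scalar_ode:
  fixes v w :: "real \<Rightarrow> complex"
  assumes deriv: "\<And>t. (v has_vector_derivative z * v t + w t) (at t)"
    and "Re z < 0" and "exp_decaying w"
  shows "exp_decaying v"
proof -
  obtain C c where w: "0 < c" "\<And>t. 0 \<le> t \<Longrightarrow> norm (w t) \<le> C * exp (- c * t)"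
    using assms(3) unfolding exp_decaying_def by blast
  have "0 \<le> C"
    using order_trans[OF norm_ge_zero w(2)[of 0]] by simp
  \<comment> \<open>Half the smaller rate: \<open>w\<close> still decays at rate \<open>d\<close>,
    and \<open>r\<close> stays positive.\<close>
  define d where "d = min c (- Re z) / 2"
  define r where "r = - Re z - d"
  have d: "0 < d" "d \<le> c" "0 < r" "Re z \<le> - d"
    using w(1) assms(2) by (auto simp: d_def r_def min_def)
  have bound: "norm (v t) \<le> (norm (v 0) + C / r) * exp (- d * t)" if "0 \<le> t" for t
  proof (cases "t = 0")
    case True
    then show ?thesis using \<open>0 \<le> C\<close> d by simp
  next
    case False
    with that have "0 < t" by simp
    define h where "h = (\<lambda>s. exp (of_real s * - z) * v s)"
    have h: "(h has_vector_derivative exp (of_real s * - z) * w s) (at s)" for s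
    proof -
      have "((\<lambda>s. exp (of_real s * - z)) has_vector_derivative (- z) * exp (of_real s * - z)) (at s)"
        using vector_derivative_chain_at_general [where f="of_real" and g="\<lambda>s. exp (s * - z)"]
        by (auto intro!: derivative_eq_intros has_vector_derivative_real_field)
      from has_vector_derivative_mult[OF this deriv] show ?thesis
        unfolding h_def by (simp add: algebra_simps)
    qed
    have "norm (h t - h 0) \<le> C / r * exp (r * t) - C / r * exp (r * 0)"
    proof (rule differentiable_bound_general[OF \<open>0 < t\<close>])
      show "continuous_on {0..t} h"
        using h by (meson continuous_at_imp_continuous_on has_vector_derivative_continuous)
      show "continuous_on {0..t} (\<lambda>s. C / r * exp (r * s))"
        by (intro continuous_intros)
      show "((\<lambda>s. C / r * exp (r * s)) has_vector_derivative C * exp (r * s)) (at s)" for s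
        using d(3) unfolding has_real_derivative_iff_has_vector_derivative[symmetric]
        by (auto intro!: derivative_eq_intros)
      fix s assume "0 < s" "s < t"
      have "norm (exp (of_real s * - z) * w s) = exp (- Re z * s) * norm (w s)"
        by (simp add: norm_mult mult.commute)
      also have "\<dots> \<le> exp (- Re z * s) * (C * exp (- d * s))"
      proof (intro mult_left_mono)
        have "C * exp (- c * s) \<le> C * exp (- d * s)"
          using d \<open>0 < s\<close> \<open>0 \<le> C\<close> by (intro mult_left_mono) auto
        then show "norm (w s) \<le> C * exp (- d * s)"
          using w(2)[of s] \<open>0 < s\<close> by simp
      qed simp
      also have "\<dots> = C * exp (r * s)"
        by (simp add: r_def exp_add[symmetric] algebra_simps)
      finally show "norm (exp (of_real s * - z) * w s) \<le> C * exp (r * s)" .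
    qed (rule h)
    moreover have "norm (h t) \<le> norm (h t - h 0) + norm (h 0)"
      using norm_triangle_ineq[of "h t - h 0" "h 0"] by simp
    moreover have "0 \<le> C / r"
      using \<open>0 \<le> C\<close> d by simp
    ultimately have h_bound: "norm (h t) \<le> norm (v 0) + C / r * exp (r * t)"
      by (simp add: h_def)
    have "v t = exp (of_real t * z) * h t"
      by (simp add: h_def mult.assoc[symmetric] exp_add[symmetric])
    then have "norm (v t) = exp (Re z * t) * norm (h t)"
      by (simp add: norm_mult mult.commute)
    also have "\<dots> \<le> exp (Re z * t) * (norm (v 0) + C / r * exp (r * t))"
      using h_bound by (intro mult_left_mono) auto
    also have "\<dots> = norm (v 0) * exp (Re z * t) + C / r * exp (- d * t)"
      by (simp add: r_def exp_add[symmetric] algebra_simps)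
    also have "\<dots> \<le> norm (v 0) * exp (- d * t) + C / r * exp (- d * t)"
      using d(4) that by (intro add_right_mono mult_left_mono) (auto intro: mult_right_mono[of _ "-d", simplified])
    finally show ?thesis
      by (simp add: distrib_right)
  qed
  then show ?thesis
    unfolding exp_decaying_def using d(1) by blast
qed

section \<open>Solutions of stable linear systems\<close>

text \<open>This is \<open>q(B) x\<close>, with iterated application of \<open>B\<close> because
  \<open>^\<close> on matrices acts componentwise.\<close>

definition poly_act :: "complex poly \<Rightarrow> complex^'n^'n \<Rightarrow> complex^'n \<Rightarrow> complex^'n" where
  "poly_act q B x = (\<Sum>i\<le>degree q. coeff q i *s ((*v) B ^^ i) x)"

lemma poly_act_eq_sum:
  assumes "degree q \<le> N"
  shows "poly_act q B x = (\<Sum>i\<le>N. coeff q i *s ((*v) B ^^ i) x)"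
  unfolding poly_act_def using assms
  by (intro sum.mono_neutral_left) (auto simp: coeff_eq_0 not_le)

lemma matrix_vector_funpow_diff_scaled:
  fixes B :: "'a::field^'n^'n"
  shows "((*v) B ^^ i) (x - z *s y) = ((*v) B ^^ i) x - z *s ((*v) B ^^ i) y"
  by (induction i) (simp_all add: matrix_vector_mult_diff_distrib vector_scalar_commute)

lemma poly_act_linear_factor:
  "poly_act ([:- z, 1:] * r) B x = poly_act r B (B *v x) - z *s poly_act r B x"
proof -
  have "degree ([:- z, 1:] * r) \<le> Suc (degree r)"
    using degree_mult_le[of "[:- z, 1:]" r] by simp
  then have "poly_act ([:- z, 1:] * r) B x
      = (\<Sum>i\<le>Suc (degree r). coeff (pCons 0 r) i *s ((*v) B ^^ i) x)
        - (\<Sum>i\<le>Suc (degree r). (z * coeff r i) *s ((*v) B ^^ i) x)"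
    by (subst poly_act_eq_sum, assumption) (simp add: vector_sub_rdistrib sum_subtractf del: sum.atMost_Suc)
  also have "(\<Sum>i\<le>Suc (degree r). coeff (pCons 0 r) i *s ((*v) B ^^ i) x)
      = (\<Sum>i\<le>degree r. coeff r i *s ((*v) B ^^ i) (B *v x))"
    by (subst sum.atMost_Suc_shift) (simp add: funpow_swap1)
  also have "(\<Sum>i\<le>Suc (degree r). (z * coeff r i) *s ((*v) B ^^ i) x)
      = z *s (\<Sum>i\<le>degree r. coeff r i *s ((*v) B ^^ i) x)"
    by (simp add: coeff_eq_0 vec.scale_sum_right)
  finally show ?thesis
    by (simp add: poly_act_def)
qed

text \<open>Combined with the preceding factor identity: if \<open>[:- z, 1:] * r\<close>
  annihilates \<open>x\<close>, then \<open>r\<close> annihilates \<open>B x - z x\<close>.\<close>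

lemma poly_act_shift:
  "poly_act r B (B *v x - z *s x) = poly_act r B (B *v x) - z *s poly_act r B x"
  by (simp add: poly_act_def matrix_vector_funpow_diff_scaled vec.scale_sum_right sum_subtractf
      vec.scale_right_diff_distrib mult.commute)

lemma poly_act_mult_commute:
  "poly_act r B (B *v x) = B *v poly_act r B x"
  by (simp add: poly_act_def funpow_swap1 vec.linear_sum[OF matrix_vector_mul_linear_gen]
     vector_scalar_commute)

text \<open>More powers of \<open>B\<close> than the real dimension of the matrix space satisfy a
  real linear relation, whose coefficients form \<open>q\<close>.\<close>

lemma ex_annihilating_poly:
  fixes B :: "complex^'n^'n"
  shows "\<exists>q. q \<noteq> 0 \<and> (\<forall>x. poly_act q B x = 0)"
proof -
  define M where "M i = ((**) B ^^ i) (mat 1)" for i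
  define N where "N = DIM(complex^'n^'n)"
  have M: "M i *v x = ((*v) B ^^ i) x" for i x
    by (induction i) (simp_all add: M_def matrix_vector_mul_assoc[symmetric])
  \<comment> \<open>\<open>dependent\<close> concerns sets, so two equal powers are treated apart:
    their difference is then the relation.\<close>
  have "\<exists>c :: nat \<Rightarrow> real. (\<exists>i\<le>N. c i \<noteq> 0) \<and> (\<Sum>i\<le>N. c i *\<^sub>R M i) = 0"
  proof (cases "inj_on M {..N}")
    case True
    then have "card (M ` {..N}) > DIM(complex^'n^'n)"
      by (simp add: card_image N_def)
    then have "dependent (M ` {..N})"
      by (rule dependent_biggerset)
    then obtain u where u: "\<exists>v\<in>M ` {..N}. u v \<noteq> 0" "(\<Sum>v\<in>M ` {..N}. u v *\<^sub>R v) = 0"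
      by (subst (asm) dependent_finite) auto
    with True show ?thesis
      by (intro exI[of _ "u \<circ> M"]) (auto simp: sum.reindex o_def)
  next
    case False
    then obtain i j where ij: "i \<le> N" "j \<le> N" "i \<noteq> j" "M i = M j"
      by (auto simp: inj_on_def)
    define c :: "nat \<Rightarrow> real" where "c k = (if k = i then 1 else 0) - (if k = j then 1 else 0)" for k
    have "(\<Sum>k\<le>N. c k *\<^sub>R M k) = (\<Sum>k\<le>N. (if k = i then M k else 0) - (if k = j then M k else 0))"
      by (intro sum.cong) (auto simp: c_def)
    also have "\<dots> = 0"
      using ij by (simp add: sum_subtractf)
    finally show ?thesis
      using ij by (intro exI[of _ c]) (auto simp: c_def intro!: exI[of _ i])
  qed
  then obtain c :: "nat \<Rightarrow> real" and k where c: "k \<le> N" "c k \<noteq> 0" "(\<Sum>i\<le>N. c i *\<^sub>R M i) = 0"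
    by blast
  define q where "q = (\<Sum>i\<le>N. monom (complex_of_real (c i)) i)"
  have coeff: "coeff q i = (if i \<le> N then of_real (c i) else 0)" for i
    by (simp add: q_def coeff_sum if_distrib cong: if_cong)
  have "q \<noteq> 0"
    using coeff[of k] c by auto
  moreover have "poly_act q B x = 0" for x
  proof -
    have "degree q \<le> N"
      by (rule degree_le) (simp add: coeff)
    then have "poly_act q B x = (\<Sum>i\<le>N. of_real (c i) *s (M i *v x))"
      by (simp add: poly_act_eq_sum coeff M)
    also have "\<dots> = (\<Sum>i\<le>N. (c i *\<^sub>R M i) *v x)"
      by (intro sum.cong refl)
        (simp add: vec_eq_iff matrix_vector_mult_def scaleR_conv_of_real[where 'a=complex] sum_distrib_left mult.assoc)
    also have "\<dots> = (\<Sum>i\<le>N. c i *\<^sub>R M i) *v x"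
      by (induction N) (simp_all add: matrix_vector_mult_add_rdistrib)
    finally have "poly_act q B x = (\<Sum>i\<le>N. c i *\<^sub>R M i) *v x" .
    then show ?thesis
      by (simp add: c)
  qed
  ultimately show ?thesis by blast
qed

text \<open>Induction on the degree, for all \<open>u\<close> at once, splitting off a root
  \<open>z\<close> with cofactor \<open>r\<close>. Unless \<open>r\<close> already annihilates the
  solution, \<open>z\<close> is an eigenvalue, so \<open>Re z < 0\<close>; then
  \<open>w = B u - z u\<close> solves the same system, is annihilated by \<open>r\<close>, hence
  decays, and \<open>u' = z u + w\<close>.\<close>

lemma exp_decaying_poly_ode:
  fixes B :: "complex^'n^'n"
  assumes stable: "\<And>z v. v \<noteq> 0 \<Longrightarrow> B *v v = z *s v \<Longrightarrow> Re z < 0"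
  assumes "q \<noteq> 0"
    and deriv: "\<And>a t. ((\<lambda>t. u t $ a) has_vector_derivative (B *v u t) $ a) (at t)"
    and "\<And>t. poly_act q B (u t) = 0"
  shows "exp_decaying (\<lambda>t. u t $ a)"
  using assms(2-)
proof (induction "degree q" arbitrary: q u a)
  case 0
  then obtain c where "q = [:c:]" "c \<noteq> 0"
    by (metis degree_eq_zeroE pCons_0_0)
  then have "u t = 0" for t
    using 0(4)[of t] by (simp add: poly_act_def)
  then show ?case
    by (simp add: exp_decaying_zero)
next
  case (Suc d)
  have "\<not> constant (poly q)"
    using Suc.hyps(2) by (simp add: constant_degree)
  then obtain z where "poly q z = 0"
    using fundamental_theorem_of_algebra by blast
  then obtain r where r: "q = [:- z, 1:] * r"
    using poly_eq_0_iff_dvd by blast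
  then have "r \<noteq> 0"
    using Suc.prems(1) by auto
  then have "degree r = d"
    using Suc.hyps(2) degree_mult_eq[of "[:- z, 1:]" r] by (simp add: r del: mult_pCons_left)
  show ?case
  proof (cases "\<forall>t. poly_act r B (u t) = 0")
    case True
    then show ?thesis
      using Suc.hyps(1)[OF _ \<open>r \<noteq> 0\<close> Suc.prems(2)] \<open>degree r = d\<close> by blast
  next
    case False
    then obtain s where "poly_act r B (u s) \<noteq> 0"
      by blast
    moreover have "B *v poly_act r B (u s) = z *s poly_act r B (u s)"
      using Suc.prems(3)[of s] by (simp add: r poly_act_linear_factor poly_act_mult_commute del: mult_pCons_left)
    ultimately have "Re z < 0"
      by (rule stable)
    define w where "w t = B *v u t - z *s u t" for t
    have w: "((\<lambda>t. w t $ b) has_vector_derivative (B *v w t) $ b) (at t)" for b t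
    proof -
      have "((\<lambda>t. (\<Sum>c\<in>UNIV. B $ b $ c * u t $ c) - z * u t $ b) has_vector_derivative
          (\<Sum>c\<in>UNIV. B $ b $ c * (B *v u t) $ c) - z * (B *v u t) $ b) (at t)"
        by (intro has_vector_derivative_diff has_vector_derivative_sum has_vector_derivative_mult_right Suc.prems(2))
      moreover have "(B *v w t) $ b = (\<Sum>c\<in>UNIV. B $ b $ c * (B *v u t) $ c) - z * (B *v u t) $ b"
        by (simp add: w_def matrix_vector_mult_diff_distrib vector_scalar_commute)
          (simp add: matrix_vector_mult_def)
      ultimately show ?thesis
        by (simp add: w_def matrix_vector_mult_def)
    qed
    have "exp_decaying (\<lambda>t. w t $ a)"
    proof (rule Suc.hyps(1)[OF _ \<open>r \<noteq> 0\<close> w])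
      show "poly_act r B (w t) = 0" for t
        using Suc.prems(3)[of t] by (simp add: w_def r poly_act_shift poly_act_linear_factor del: mult_pCons_left)
    qed (use \<open>degree r = d\<close> in simp)
    moreover have "((\<lambda>t. u t $ a) has_vector_derivative z * u t $ a + w t $ a) (at t)" for t
      using Suc.prems(2)[of a t] by (simp add: w_def)
    ultimately show ?thesis
      using \<open>Re z < 0\<close> by (intro exp_decaying_scalar_ode[of "\<lambda>t. u t $ a" z "\<lambda>t. w t $ a"])
  qed
qed

section \<open>The matrix exponential and the Gramians\<close>

text \<open>The sum of all absolute entries dominates every row sum, so each factor \<open>A\<close>
  costs one such constant. This gives the majorant for the exponential series.\<close>

lemma matrix_power_entry_bound:
  fixes A :: "real^'n^'n"
  shows "\<bar>((**) A ^^ k) (mat 1) $ a $ b\<bar> \<le> (\<Sum>i\<in>UNIV. \<Sum>j\<in>UNIV. \<bar>A $ i $ j\<bar>) ^ k"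
proof (induction k arbitrary: a)
  case 0
  then show ?case by (simp add: mat_def)
next
  case (Suc k)
  let ?K = "\<Sum>i\<in>UNIV. \<Sum>j\<in>UNIV. \<bar>A $ i $ j\<bar>"
  have "\<bar>((**) A ^^ Suc k) (mat 1) $ a $ b\<bar> = \<bar>\<Sum>c\<in>UNIV. A $ a $ c * ((**) A ^^ k) (mat 1) $ c $ b\<bar>"
    by (simp add: matrix_matrix_mult_def)
  also have "\<dots> \<le> (\<Sum>c\<in>UNIV. \<bar>A $ a $ c\<bar> * \<bar>((**) A ^^ k) (mat 1) $ c $ b\<bar>)"
    by (rule order_trans[OF sum_abs]) (simp add: abs_mult)
  also have "\<dots> \<le> (\<Sum>c\<in>UNIV. \<bar>A $ a $ c\<bar> * ?K ^ k)"
    using Suc by (intro sum_mono mult_left_mono) auto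
  also have "\<dots> = (\<Sum>c\<in>UNIV. \<bar>A $ a $ c\<bar>) * ?K ^ k"
    by (simp add: sum_distrib_right)
  also have "\<dots> \<le> ?K * ?K ^ k"
    by (intro mult_right_mono zero_le_power sum_nonneg member_le_sum[of a UNIV "\<lambda>i. \<Sum>j\<in>UNIV. \<bar>A $ i $ j\<bar>"]) auto
  finally show ?case by simp
qed

lemma summable_mat_exp_entry:
  fixes A :: "real^'n^'n"
  shows "summable (\<lambda>k. ((**) A ^^ k) (mat 1) $ a $ b / fact k * t ^ k)"
proof (rule summable_comparison_test')
  let ?K = "\<Sum>i\<in>UNIV. \<Sum>j\<in>UNIV. \<bar>A $ i $ j\<bar>"
  show "summable (\<lambda>k. (?K * \<bar>t\<bar>) ^ k /\<^sub>R fact k)"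
    by (rule summable_exp_generic)
  show "norm (((**) A ^^ k) (mat 1) $ a $ b / fact k * t ^ k) \<le> (?K * \<bar>t\<bar>) ^ k /\<^sub>R fact k" for k
    using mult_right_mono[OF matrix_power_entry_bound[where A = A and k = k and a = a and b = b], of "\<bar>t\<bar> ^ k"]
    by (simp add: abs_mult power_abs power_mult_distrib divide_simps)
qed

lemma funpow_scaleR_matrix_mult:
  fixes A M :: "real^'n^'n"
  shows "((**) (t *\<^sub>R A) ^^ k) M = t ^ k *\<^sub>R ((**) A ^^ k) M"
  by (induction k) (simp_all add: vec_eq_iff matrix_matrix_mult_def sum_distrib_left mult_ac)

lemma mat_exp_entry:
  fixes A :: "real^'n^'n"
  shows "mat_exp (t *\<^sub>R A) $ a $ b = (\<Sum>k. ((**) A ^^ k) (mat 1) $ a $ b / fact k * t ^ k)"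
proof -
  have "(\<lambda>k. (1 / fact k) *\<^sub>R ((**) (t *\<^sub>R A) ^^ k) (mat 1)) sums
      (\<chi> a b. \<Sum>k. ((**) A ^^ k) (mat 1) $ a $ b / fact k * t ^ k)"
    unfolding sums_def
  proof (intro vec_tendstoI)
    fix a b
    show "(\<lambda>n. (\<Sum>k<n. (1 / fact k) *\<^sub>R ((**) (t *\<^sub>R A) ^^ k) (mat 1)) $ a $ b)
        \<longlonglongrightarrow> (\<chi> a b. \<Sum>k. ((**) A ^^ k) (mat 1) $ a $ b / fact k * t ^ k) $ a $ b"
      using summable_LIMSEQ[OF summable_mat_exp_entry[of A a b t]]
      by (simp add: sum_component funpow_scaleR_matrix_mult mult_ac)
  qed
  from sums_unique[OF this] show ?thesis
    unfolding mat_exp_def by (metis (no_types, lifting) vec_lambda_beta)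
qed

lemma mat_exp_zero: "mat_exp (0 *\<^sub>R A) = mat 1"
proof -
  have "mat_exp (0 *\<^sub>R A) $ a $ b = mat 1 $ a $ b" for a b
    unfolding mat_exp_entry using powser_zero[of "\<lambda>k. ((**) A ^^ k) (mat 1) $ a $ b / fact k"] by simp
  then show ?thesis
    by (simp add: vec_eq_iff)
qed

lemma has_real_derivative_mat_exp:
  fixes A :: "real^'n^'n"
  shows "((\<lambda>t. mat_exp (t *\<^sub>R A) $ a $ b) has_real_derivative (A ** mat_exp (t *\<^sub>R A)) $ a $ b) (at t)"
proof -
  define c where "c a k = ((**) A ^^ k) (mat 1) $ a $ b / fact k" for a k
  have sm: "summable (\<lambda>k. c a k * s ^ k)" for a s
    unfolding c_def by (rule summable_mat_exp_entry)
  \<comment> \<open>\<open>diffs\<close> cancels \<open>Suc k\<close> against the factorial and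
    leaves the power \<open>Suc k\<close> of \<open>A\<close>, which is \<open>A\<close> times the
    power \<open>k\<close>.\<close>
  have "diffs (c a) k = (\<Sum>i\<in>UNIV. A $ a $ i * c i k)" for k
    by (simp add: diffs_def c_def matrix_matrix_mult_def del: of_nat_Suc)
      (simp flip: sum_divide_distrib)
  then have "(\<Sum>k. diffs (c a) k * t ^ k) = (\<Sum>k. \<Sum>i\<in>UNIV. A $ a $ i * (c i k * t ^ k))"
    by (simp add: sum_distrib_right mult.assoc)
  also have "\<dots> = (\<Sum>i\<in>UNIV. A $ a $ i * (\<Sum>k. c i k * t ^ k))"
    by (subst suminf_sum) (auto intro!: summable_mult sm simp: suminf_mult[OF sm])
  finally have "(\<Sum>k. diffs (c a) k * t ^ k) = (A ** mat_exp (t *\<^sub>R A)) $ a $ b"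
    by (simp add: matrix_matrix_mult_def mat_exp_entry c_def)
  with termdiffs_strong_converges_everywhere[of "c a" t, OF sm] show ?thesis
    by (simp add: mat_exp_entry c_def)
qed

lemma matrix_power_commute:
  fixes A :: "real^'n^'n"
  shows "A ** ((**) A ^^ k) (mat 1) = ((**) A ^^ k) (mat 1) ** A"
  by (induction k) (simp_all add: matrix_mul_assoc)

lemma mat_exp_transpose:
  fixes A :: "real^'n^'n"
  shows "mat_exp (t *\<^sub>R transpose A) = transpose (mat_exp (t *\<^sub>R A))"
proof -
  have "((**) (transpose A) ^^ k) (mat 1) = transpose (((**) A ^^ k) (mat 1))" for k
    by (induction k) (simp_all add: matrix_power_commute matrix_transpose_mul transpose_mat)
  then show ?thesis
    by (simp add: vec_eq_iff mat_exp_entry transpose_def)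
qed

text \<open>Over the complex numbers each column of \<open>exp (A t)\<close> solves
  \<open>u' = B u\<close>, so the polynomial argument applies.\<close>

lemma exp_decaying_mat_exp:
  fixes A :: "real^'n^'n"
  assumes "stable_matrix A"
  shows "exp_decaying (\<lambda>t. mat_exp (t *\<^sub>R A) $ a $ b)"
proof -
  define B where "B = map_matrix complex_of_real A"
  define u where "u t = (\<chi> a. complex_of_real (mat_exp (t *\<^sub>R A) $ a $ b))" for t
  obtain q where q: "q \<noteq> 0" "\<And>x. poly_act q B x = 0"
    using ex_annihilating_poly by blast
  have "exp_decaying (\<lambda>t. u t $ a)"
  proof (rule exp_decaying_poly_ode[OF _ q(1)])
    show "Re z < 0" if "v \<noteq> 0" "B *v v = z *s v" for z v
      using assms that unfolding stable_matrix_def B_def by blast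
    fix a t
    have "((\<lambda>t. of_real (mat_exp (t *\<^sub>R A) $ a $ b)) has_vector_derivative
        complex_of_real ((A ** mat_exp (t *\<^sub>R A)) $ a $ b)) (at t)"
      by (intro has_vector_derivative_of_real has_real_derivative_mat_exp)
    then show "((\<lambda>t. u t $ a) has_vector_derivative (B *v u t) $ a) (at t)"
      by (simp add: u_def B_def matrix_vector_mult_def matrix_matrix_mult_def map_matrix_def)
  qed (rule q(2))
  then show ?thesis
    by (simp add: u_def exp_decaying_def)
qed

section \<open>Entries, semidefiniteness and Lyapunov equation of the Gramians\<close>

lemma has_integral_vecI:
  fixes f :: "real \<Rightarrow> 'a::euclidean_space^'n"
  assumes "\<And>i. ((\<lambda>t. f t $ i) has_integral y $ i) S"
  shows "(f has_integral y) S"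
proof (rule has_integral_componentwise)
  fix b :: "'a^'n" assume "b \<in> Basis"
  then obtain i c where b: "b = axis i c" "c \<in> Basis"
    by (auto simp: Basis_vec_def)
  show "((\<lambda>t. f t \<bullet> b) has_integral y \<bullet> b) S"
    using has_integral_linear[OF assms bounded_linear_inner_left[of c], of i]
    by (simp add: b inner_axis o_def)
qed

lemma gramian_integrand:
  fixes A :: "real^'n^'n"
  shows "(mat_exp (t *\<^sub>R A) ** outer_prod (axis i 1) (axis i 1) ** mat_exp (t *\<^sub>R transpose A)) $ a $ b
    = mat_exp (t *\<^sub>R A) $ a $ i * mat_exp (t *\<^sub>R A) $ b $ i"
proof -
  have "(M ** outer_prod (axis i 1) (axis i 1)) $ a $ c = (if c = i then M $ a $ i else 0)"
    for M :: "real^'n^'n" and c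
    by (simp add: matrix_matrix_mult_def outer_prod_def axis_def if_distrib[of "\<lambda>x. _ * x"] cong: if_cong)
  then have "(M ** outer_prod (axis i 1) (axis i 1) ** transpose M) $ a $ b = M $ a $ i * M $ b $ i"
    for M :: "real^'n^'n"
    by (subst matrix_matrix_mult_def) (simp add: transpose_def if_distrib[of "\<lambda>x. x * _"] cong: if_cong)
  then show ?thesis
    by (simp add: mat_exp_transpose)
qed

lemma continuous_on_mat_exp:
  fixes A :: "real^'n^'n"
  shows "continuous_on S (\<lambda>t. mat_exp (t *\<^sub>R A) $ a $ b)"
  by (intro continuous_at_imp_continuous_on ballI DERIV_isCont[OF has_real_derivative_mat_exp])

text \<open>\<open>integral\<close> is meaningful only for integrable functions; exponential decay
  provides integrability entry by entry.\<close>

lemma gramian_entry: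
  fixes A :: "real^'n^'n"
  assumes "stable_matrix A"
  shows "((\<lambda>t. mat_exp (t *\<^sub>R A) $ a $ i * mat_exp (t *\<^sub>R A) $ b $ i) has_integral gramian A i $ a $ b) {0..}"
proof -
  define y where "y a b = integral {0..} (\<lambda>t. mat_exp (t *\<^sub>R A) $ a $ i * mat_exp (t *\<^sub>R A) $ b $ i)" for a b
  have int: "((\<lambda>t. mat_exp (t *\<^sub>R A) $ a $ i * mat_exp (t *\<^sub>R A) $ b $ i) has_integral y a b) {0..}" for a b
    unfolding y_def
    by (intro integrable_integral set_lebesgue_integral_eq_integral exp_decaying_absolutely_integrable
        exp_decaying_mult exp_decaying_mat_exp assms continuous_intros continuous_on_mat_exp)
  have "((\<lambda>t. mat_exp (t *\<^sub>R A) ** outer_prod (axis i 1) (axis i 1) ** mat_exp (t *\<^sub>R transpose A))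
      has_integral (\<chi> a b. y a b)) {0..}"
    using int by (intro has_integral_vecI) (simp add: gramian_integrand)
  then have "gramian A i = (\<chi> a b. y a b)"
    unfolding gramian_def by (rule integral_unique)
  with int show ?thesis by simp
qed

lemma transpose_gramian:
  fixes A :: "real^'n^'n"
  assumes "stable_matrix A"
  shows "transpose (gramian A i) = gramian A i"
proof -
  have "gramian A i $ b $ a = gramian A i $ a $ b" for a b
    using has_integral_unique[OF gramian_entry[OF assms, of a i b]] gramian_entry[OF assms, of b i a]
    by (simp add: mult.commute)
  then show ?thesis
    by (simp add: vec_eq_iff transpose_def)
qed

text \<open>The integrand of the quadratic form is a square.\<close>

lemma gramian_psd:
  fixes A :: "real^'n^'n"
  assumes "stable_matrix A"
  shows "0 \<le> x \<bullet> (gramian A i *v x)"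
proof -
  have "((\<lambda>t. \<Sum>a\<in>UNIV. \<Sum>b\<in>UNIV. x $ a * x $ b * (mat_exp (t *\<^sub>R A) $ a $ i * mat_exp (t *\<^sub>R A) $ b $ i))
      has_integral (\<Sum>a\<in>UNIV. \<Sum>b\<in>UNIV. x $ a * x $ b * gramian A i $ a $ b)) {0..}"
    by (intro has_integral_sum has_integral_mult_right gramian_entry assms) auto
  moreover have "(\<Sum>a\<in>UNIV. \<Sum>b\<in>UNIV. x $ a * x $ b * (mat_exp (t *\<^sub>R A) $ a $ i * mat_exp (t *\<^sub>R A) $ b $ i))
      = (\<Sum>a\<in>UNIV. x $ a * mat_exp (t *\<^sub>R A) $ a $ i)\<^sup>2" for t
    unfolding power2_eq_square sum_product by (intro sum.cong refl) (simp only: mult_ac)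
  ultimately have "((\<lambda>t. (\<Sum>a\<in>UNIV. x $ a * mat_exp (t *\<^sub>R A) $ a $ i)\<^sup>2)
      has_integral (\<Sum>a\<in>UNIV. \<Sum>b\<in>UNIV. x $ a * x $ b * gramian A i $ a $ b)) {0..}"
    by (simp only:)
  then have "0 \<le> (\<Sum>a\<in>UNIV. \<Sum>b\<in>UNIV. x $ a * x $ b * gramian A i $ a $ b)"
    by (rule has_integral_nonneg) simp
  also have "\<dots> = x \<bullet> (gramian A i *v x)"
    unfolding inner_vec_def matrix_vector_mult_def inner_real_def vec_lambda_beta sum_distrib_left
    by (intro sum.cong refl) (simp only: mult_ac)
  finally show ?thesis .
qed

text \<open>The integrand \<open>F\<close> of the Gramian satisfies \<open>F' = A F + F A\<^sup>T\<close>, \<open>F 0 = e\<^sub>i e\<^sub>i\<^sup>T\<close> and vanishes at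
  infinity.\<close>

lemma gramian_lyapunov:
  fixes A :: "real^'n^'n"
  assumes "stable_matrix A"
  shows "A ** gramian A i + gramian A i ** transpose A = - outer_prod (axis i 1) (axis i 1)"
proof -
  have "(A ** gramian A i + gramian A i ** transpose A) $ a $ b = - outer_prod (axis i 1) (axis i 1) $ a $ b" for a b
  proof -
    define E where "E a t = mat_exp (t *\<^sub>R A) $ a $ i" for a t
    define f where "f t = (\<Sum>c\<in>UNIV. A $ a $ c * (E c t * E b t)) + (\<Sum>c\<in>UNIV. A $ b $ c * (E a t * E c t))" for t
    have E: "exp_decaying (E c)" "continuous_on S (E c)" for c S
      unfolding E_def by (intro exp_decaying_mat_exp assms continuous_on_mat_exp)+
    have E': "(E c has_real_derivative (\<Sum>d\<in>UNIV. A $ c $ d * E d t)) (at t)" for c t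
      using has_real_derivative_mat_exp[of A c i t] unfolding E_def by (simp add: matrix_matrix_mult_def)
    have "(f has_integral - (E a 0 * E b 0)) {0..}"
    proof (rule has_integral_derivative_exp_decaying)
      show "exp_decaying (\<lambda>t. E a t * E b t)" "exp_decaying f"
        unfolding f_def by (intro exp_decaying_mult exp_decaying_add exp_decaying_sum exp_decaying_cmult E)+
      show "continuous_on {0..} f"
        unfolding f_def by (intro continuous_intros E)
      show "((\<lambda>t. E a t * E b t) has_vector_derivative f t) (at t)" for t
        unfolding has_real_derivative_iff_has_vector_derivative[symmetric] f_def
        by (rule DERIV_cong[OF DERIV_mult[OF E' E']]) (simp add: sum_distrib_left sum_distrib_right mult_ac)
    qed
    moreover have "(f has_integral (\<Sum>c\<in>UNIV. A $ a $ c * gramian A i $ c $ b) + (\<Sum>c\<in>UNIV. A $ b $ c * gramian A i $ a $ c)) {0..}"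
      unfolding f_def E_def
      by (intro has_integral_sum has_integral_add has_integral_mult_right gramian_entry assms) auto
    ultimately have "(\<Sum>c\<in>UNIV. A $ a $ c * gramian A i $ c $ b) + (\<Sum>c\<in>UNIV. A $ b $ c * gramian A i $ a $ c)
        = - (E a 0 * E b 0)"
      using has_integral_unique by blast
    then show ?thesis
      using mat_exp_zero[of A]
      by (simp add: matrix_matrix_mult_def transpose_def outer_prod_def E_def mat_def axis_def mult.commute)
  qed
  then show ?thesis
    by (simp add: vec_eq_iff)
qed

section \<open>Strict concavity of the logarithm of the determinant\<close>

lemma pos_defD:
  assumes "pos_def P"
  shows "transpose P = P" "x \<noteq> 0 \<Longrightarrow> 0 < x \<bullet> (P *v x)"
  using assms by (auto simp: pos_def_def)

lemma symmetric_matrix_inner: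
  fixes M :: "real^'n^'n"
  assumes "transpose M = M"
  shows "x \<bullet> (M *v y) = y \<bullet> (M *v x)"
  by (metis assms dot_lmul_matrix inner_commute transpose_matrix_vector)

lemma transpose_zero: "transpose 0 = 0"
  by (simp add: transpose_def vec_eq_iff)

lemma matrix_mult_add_rdistrib: "(M + N) ** C = M ** C + N ** C"
  by (vector matrix_matrix_mult_def sum.distrib distrib_right)

lemma congruence_inner:
  fixes B M :: "real^'n^'n"
  shows "x \<bullet> ((transpose B ** M ** B) *v y) = (B *v x) \<bullet> (M *v (B *v y))"
proof -
  have "x \<bullet> ((transpose B ** M ** B) *v y) = ((M *v (B *v y)) v* B) \<bullet> x"
    by (simp add: matrix_vector_mul_assoc[symmetric] inner_commute)
  then show ?thesis
    by (metis dot_lmul_matrix inner_commute)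
qed

lemma continuous_on_quadratic_form:
  fixes M :: "real^'n^'n"
  shows "continuous_on S (\<lambda>x. x \<bullet> (M *v x))"
  by (intro continuous_intros linear_continuous_on matrix_vector_mul_bounded_linear)

lemma quadratic_nonneg_imp_linear_zero:
  fixes a b :: real
  assumes "\<And>t. 0 \<le> 2 * t * b + t\<^sup>2 * a"
  shows "b = 0"
proof (rule ccontr)
  assume "b \<noteq> 0"
  \<comment> \<open>The summand 1 makes \<open>c\<close> positive even for \<open>a = 0\<close>;
    \<open>t = - b / c\<close> minimises the upper bound obtained by replacing \<open>a\<close> with
    \<open>c\<close>.\<close>
  define c where "c = \<bar>a\<bar> + 1"
  have "0 < c" "a \<le> c"
    by (auto simp: c_def)
  define t where "t = - b / c"
  have "2 * t * b + t\<^sup>2 * a \<le> 2 * t * b + t\<^sup>2 * c"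
    using \<open>a \<le> c\<close> by (intro add_left_mono mult_left_mono) auto
  also have "\<dots> = - b\<^sup>2 / c"
    using \<open>0 < c\<close> by (simp add: t_def field_simps power2_eq_square)
  also have "\<dots> < 0"
    using \<open>b \<noteq> 0\<close> \<open>0 < c\<close> by (intro divide_neg_pos) auto
  finally show False
    using assms[of t] by simp
qed

text \<open>On \<open>V\<close> the form attains its minimum \<open>0\<close> at \<open>x\<close>,
  so its derivative at \<open>x\<close> vanishes in every direction \<open>y\<close> of
  \<open>V\<close>.\<close>

lemma psd_form_zero_imp:
  fixes M :: "real^'n^'n"
  assumes sym: "transpose M = M" and V: "subspace V" and psd: "\<And>y. y \<in> V \<Longrightarrow> 0 \<le> y \<bullet> (M *v y)"
    and x: "x \<in> V" "x \<bullet> (M *v x) = 0" and y: "y \<in> V"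
  shows "y \<bullet> (M *v x) = 0"
proof (rule quadratic_nonneg_imp_linear_zero)
  fix t
  have "x + t *\<^sub>R y \<in> V"
    using V x y by (intro subspace_add subspace_mul)
  from psd[OF this] show "0 \<le> 2 * t * (y \<bullet> (M *v x)) + t\<^sup>2 * (y \<bullet> (M *v y))"
    using x(2) symmetric_matrix_inner[OF sym, of x y]
    by (simp add: matrix_vector_right_distrib matrix_vector_mult_scaleR inner_add_left inner_add_right
        power2_eq_square algebra_simps)
qed

text \<open>Generalised eigenvectors are found one at a time, each maximising \<open>x \<bullet> H x\<close> over the vectors with
  \<open>x \<bullet> P x = 1\<close> that are \<open>P\<close>-orthogonal to the previous ones.\<close>

lemma ex_generalised_eigenvectors:
  fixes P H :: "real^'n^'n" and I :: "'n set"
  assumes P: "pos_def P" and H: "transpose H = H"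
  shows "\<exists>b l. \<forall>i\<in>I. H *v b i = l i *\<^sub>R (P *v b i) \<and> (\<forall>j\<in>I. b i \<bullet> (P *v b j) = (if i = j then 1 else 0))"
    (is "\<exists>b l. ?Q I b l")
proof -
  have "finite I" by simp
  then show ?thesis
  proof (induction I rule: finite_induct)
    case empty
    then show ?case by simp
  next
    case (insert k I)
    then obtain b l where bl: "?Q I b l"
      by blast
    define V where "V = {x. \<forall>i\<in>I. x \<bullet> (P *v b i) = 0}"
    have V: "subspace V"
      by (auto simp: subspace_def V_def inner_add_left)
    have "card I < CARD('n)"
      using insert.hyps by (intro psubset_card_mono) auto
    \<comment> \<open>Fewer orthogonality conditions than dimensions leave a nonzero vector, so
      \<open>V\<close> meets the unit sphere.\<close>
    then have "dim ((\<lambda>i. P *v b i) ` I) < DIM(real^'n)"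
      using dim_le_card'[of "(\<lambda>i. P *v b i) ` I"] card_image_le[of I "\<lambda>i. P *v b i"] by simp
    then obtain x0 where x0: "x0 \<noteq> 0" "\<And>y. y \<in> span ((\<lambda>i. P *v b i) ` I) \<Longrightarrow> orthogonal x0 y"
      using orthogonal_to_subspace_exists by blast
    then have "x0 \<in> V"
      by (auto simp: V_def orthogonal_def span_base)
    \<comment> \<open>The quotient maximised below is invariant under scaling, so the compact
      Euclidean sphere can replace the normalisation \<open>x \<bullet> P x = 1\<close> until the
      end.\<close>
    define S where "S = sphere (0::real^'n) 1 \<inter> V"
    have "compact S" "S \<noteq> {}"
    proof -
      show "compact S"
        unfolding S_def using closed_subspace[OF V] by (intro compact_Int_closed) auto
      have "(1 / norm x0) *\<^sub>R x0 \<in> S"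
        using x0(1) \<open>x0 \<in> V\<close> V by (auto simp: S_def intro: subspace_mul)
      then show "S \<noteq> {}" by blast
    qed
    have pos: "0 < y \<bullet> (P *v y)" if "y \<noteq> 0" for y
      using pos_defD(2)[OF P that] .
    have "y \<bullet> (P *v y) \<noteq> 0" if "y \<in> S" for y
      using pos[of y] that by (force simp: S_def)
    then have "continuous_on S (\<lambda>y. (y \<bullet> (H *v y)) / (y \<bullet> (P *v y)))"
      by (intro continuous_on_divide continuous_on_quadratic_form) auto
    then obtain x where x: "x \<in> S" "\<And>y. y \<in> S \<Longrightarrow> (y \<bullet> (H *v y)) / (y \<bullet> (P *v y)) \<le> (x \<bullet> (H *v x)) / (x \<bullet> (P *v x))"
      using continuous_attains_sup[OF \<open>compact S\<close> \<open>S \<noteq> {}\<close>] by blast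
    have "x \<noteq> 0" "x \<in> V"
      using x(1) by (auto simp: S_def)
    define m where "m = (x \<bullet> (H *v x)) / (x \<bullet> (P *v x))"
    define N where "N = m *\<^sub>R P - H"
    have N_mult: "N *v y = m *\<^sub>R (P *v y) - H *v y" for y
      by (simp add: N_def matrix_vector_mult_diff_rdistrib scaleR_matrix_vector_assoc)
    have N_sym: "transpose N = N"
      using H pos_defD(1)[OF P] by (simp add: N_def transpose_def vec_eq_iff)
    have N_psd: "0 \<le> y \<bullet> (N *v y)" if "y \<in> V" for y
    proof (cases "y = 0")
      case False
      let ?z = "(1 / norm y) *\<^sub>R y"
      have "?z \<in> S"
        using False \<open>y \<in> V\<close> V by (auto simp: S_def intro: subspace_mul)
      then have "(?z \<bullet> (H *v ?z)) / (?z \<bullet> (P *v ?z)) \<le> m"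
        unfolding m_def by (rule x(2))
      then have "(y \<bullet> (H *v y)) / (y \<bullet> (P *v y)) \<le> m"
        using False by (simp add: matrix_vector_mult_scaleR)
      then show ?thesis
        using pos[OF False] by (simp add: N_mult inner_diff_right divide_simps)
    qed simp
    have N_x: "x \<bullet> (N *v x) = 0"
      using pos[OF \<open>x \<noteq> 0\<close>] by (simp add: N_mult inner_diff_right m_def)
    \<comment> \<open>Semidefiniteness makes \<open>N x\<close> orthogonal to \<open>V\<close>. Any
      \<open>y\<close> differs from its \<open>P\<close>-orthogonal remainder \<open>r\<close> in
      \<open>V\<close> by a combination of the \<open>b i\<close>, and \<open>N\<close> maps
      \<open>b i\<close> to a multiple of \<open>P b i\<close>, which is orthogonal to
      \<open>x\<close>.\<close>
    have "N *v x = 0"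
    proof -
      have "y \<bullet> (N *v x) = 0" for y
      proof -
        define r where "r = y - (\<Sum>i\<in>I. (y \<bullet> (P *v b i)) *\<^sub>R b i)"
        have "r \<bullet> (P *v b j) = 0" if "j \<in> I" for j
        proof -
          have "(\<Sum>i\<in>I. (y \<bullet> (P *v b i)) * (b i \<bullet> (P *v b j))) = (\<Sum>i\<in>I. if i = j then y \<bullet> (P *v b i) else 0)"
            using bl that by (intro sum.cong) auto
          also have "\<dots> = y \<bullet> (P *v b j)"
            using that by simp
          finally show ?thesis
            by (simp add: r_def inner_diff_left inner_sum_left)
        qed
        then have "r \<in> V"
          by (simp add: V_def)
        then have "r \<bullet> (N *v x) = 0"
          by (intro psd_form_zero_imp[OF N_sym V N_psd \<open>x \<in> V\<close> N_x])
        moreover have "b i \<bullet> (N *v x) = 0" if "i \<in> I" for i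
        proof -
          have "b i \<bullet> (N *v x) = x \<bullet> (N *v b i)"
            by (rule symmetric_matrix_inner[OF N_sym])
          also have "\<dots> = 0"
            using bl that \<open>x \<in> V\<close> by (simp add: N_mult V_def inner_diff_right)
          finally show ?thesis .
        qed
        ultimately show ?thesis
          by (simp add: r_def inner_diff_left inner_sum_left)
      qed
      then show ?thesis
        by (metis inner_eq_zero_iff)
    qed
    define s where "s = sqrt (x \<bullet> (P *v x))"
    have s: "s \<noteq> 0" "x \<bullet> (P *v x) = s * s"
      using pos[OF \<open>x \<noteq> 0\<close>] by (simp_all add: s_def)
    define c where "c = (1 / s) *\<^sub>R x"
    have c: "H *v c = m *\<^sub>R (P *v c)" "c \<bullet> (P *v c) = 1" "c \<in> V"
    proof -
      have "H *v x = m *\<^sub>R (P *v x)"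
        using \<open>N *v x = 0\<close> by (simp add: N_mult)
      then show "H *v c = m *\<^sub>R (P *v c)"
        by (simp add: c_def matrix_vector_mult_scaleR)
      show "c \<bullet> (P *v c) = 1"
        using s by (simp add: c_def matrix_vector_mult_scaleR)
      show "c \<in> V"
        unfolding c_def by (rule subspace_mul[OF V \<open>x \<in> V\<close>])
    qed
    have "b i \<bullet> (P *v c) = 0" "c \<bullet> (P *v b i) = 0" if "i \<in> I" for i
      using c(3) that symmetric_matrix_inner[OF pos_defD(1)[OF P], of "b i" c] by (auto simp: V_def)
    then have "?Q (insert k I) (b(k := c)) (l(k := m))"
      using bl c insert.hyps by auto
    then show ?case by blast
  qed
qed

text \<open>The generalised eigenvectors, found for the whole index set, become the columns of
  \<open>B\<close>.\<close>

lemma simultaneous_diagonalisation: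
  fixes P H :: "real^'n^'n"
  assumes "pos_def P" "transpose H = H"
  obtains B :: "real^'n^'n" and l where "transpose B ** P ** B = mat 1"
    "transpose B ** H ** B = (\<chi> i j. if i = j then l i else 0)"
proof -
  obtain b l where "\<forall>i\<in>(UNIV :: 'n set). H *v b i = l i *\<^sub>R (P *v b i)
      \<and> (\<forall>j\<in>UNIV. b i \<bullet> (P *v b j) = (if i = j then 1 else 0))"
    using ex_generalised_eigenvectors[OF assms, of UNIV] by (elim exE)
  then have bl: "H *v b i = l i *\<^sub>R (P *v b i)"
    "b i \<bullet> (P *v b j) = (if i = j then 1 else 0)" for i j
    by simp_all
  define B :: "real^'n^'n" where "B = (\<chi> i j. b j $ i)"
  have entry: "(transpose B ** M ** B) $ i $ j = b i \<bullet> (M *v b j)" for M :: "real^'n^'n" and i j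
  proof -
    have "(M ** B) $ k $ j = (M *v b j) $ k" for k
      by (simp add: matrix_matrix_mult_def matrix_vector_mult_def B_def)
    then show ?thesis
      unfolding matrix_mul_assoc[symmetric]
      by (subst matrix_matrix_mult_def) (simp add: transpose_def B_def inner_vec_def)
  qed
  show thesis
  proof
    show "transpose B ** P ** B = mat 1"
      using bl(2) by (simp add: vec_eq_iff entry mat_def)
    show "transpose B ** H ** B = (\<chi> i j. if i = j then l i else 0)"
      by (simp add: vec_eq_iff entry bl)
  qed
qed

lemma det_congruence:
  fixes B M :: "'a::comm_ring_1^'n^'n"
  shows "det (transpose B ** M ** B) = (det B)\<^sup>2 * det M"
  by (simp add: det_mul power2_eq_square)

lemma pos_def_det_pos:
  fixes P :: "real^'n^'n"
  assumes "pos_def P"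
  shows "0 < det P"
proof -
  obtain B :: "real^'n^'n" where "transpose B ** P ** B = mat 1"
    using simultaneous_diagonalisation[OF assms, of 0] transpose_zero by metis
  then have "(det B)\<^sup>2 * det P = 1"
    using det_congruence[of B P] by simp
  then show ?thesis
    by (metis zero_le_power2 zero_less_mult_pos zero_less_one order_less_le mult_zero_left)
qed

text \<open>A vector on which a semidefinite form vanishes lies in the kernel, which is trivial
  here. On the simplex this turns membership in \<open>X_set\<close> into a condition on the
  determinant.\<close>

lemma psd_det_nonzero_imp_pos_def:
  fixes P :: "real^'n^'n"
  assumes sym: "transpose P = P" and psd: "\<And>x. 0 \<le> x \<bullet> (P *v x)" and "det P \<noteq> 0"
  shows "pos_def P"
  unfolding pos_def_def
proof (intro conjI allI impI sym)
  fix x :: "real^'n" assume "x \<noteq> 0"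
  show "0 < x \<bullet> (P *v x)"
  proof (rule ccontr)
    assume "\<not> ?thesis"
    then have "x \<bullet> (P *v x) = 0"
      using psd[of x] by simp
    then have "y \<bullet> (P *v x) = 0" for y
      using psd_form_zero_imp[OF sym subspace_UNIV, of x y] psd by simp
    then have "P *v x = 0"
      by (metis inner_eq_zero_iff)
    then show False
      using \<open>det P \<noteq> 0\<close> \<open>x \<noteq> 0\<close> by (metis invertible_det_nz invertible_left_inverse matrix_left_invertible_ker)
  qed
qed

text \<open>After a simultaneous diagonalisation, \<open>det (P + t H) = det P * (\<Prod>i. 1 + t \<lambda>\<^sub>i)\<close>, and the claim is
  \<open>ln (1 + \<lambda>\<^sub>i) < \<lambda>\<^sub>i\<close> unless \<open>\<lambda>\<^sub>i = 0\<close>.\<close>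

lemma ln_det_strictly_concave:
  fixes P H :: "real^'n^'n"
  assumes P: "pos_def P" and PH: "pos_def (P + H)" and "H \<noteq> 0"
    and deriv: "((\<lambda>t. ln (det (P + t *\<^sub>R H))) has_real_derivative D) (at 0)"
  shows "ln (det (P + H)) < ln (det P) + D"
proof -
  have "transpose (P + H) = transpose P + transpose H"
    by (simp add: transpose_def vec_eq_iff)
  then have H: "transpose H = H"
    using pos_defD(1)[OF P] pos_defD(1)[OF PH] by simp
  obtain B :: "real^'n^'n" and l where B: "transpose B ** P ** B = mat 1"
    "transpose B ** H ** B = (\<chi> i j. if i = j then l i else 0)"
    using simultaneous_diagonalisation[OF P H] .
  have diag: "transpose B ** (P + t *\<^sub>R H) ** B = (\<chi> i j. if i = j then 1 + t * l i else 0)" for t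
    using B unfolding vec_eq_iff
    by (simp add: matrix_add_ldistrib matrix_mult_add_rdistrib mat_def scalar_matrix_assoc[symmetric] matrix_scalar_ac)
  have detB: "(det B)\<^sup>2 * det P = 1"
    using det_congruence[of B P] B(1) by simp
  then have "det B \<noteq> 0" by auto
  then obtain C where C: "C ** B = mat 1" "B ** C = mat 1"
    by (metis invertible_def invertible_det_nz)
  have det: "det (P + t *\<^sub>R H) = det P * (\<Prod>i\<in>UNIV. 1 + t * l i)" for t
  proof -
    have "(det B)\<^sup>2 * det (P + t *\<^sub>R H) = (\<Prod>i\<in>UNIV. 1 + t * l i)"
      unfolding det_congruence[symmetric] diag by (subst det_diagonal) auto
    then have "(det B)\<^sup>2 * det (P + t *\<^sub>R H) = (det B)\<^sup>2 * (det P * (\<Prod>i\<in>UNIV. 1 + t * l i))"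
      using detB by (simp add: mult.assoc[symmetric])
    then show ?thesis
      using \<open>det B \<noteq> 0\<close> by simp
  qed
  \<comment> \<open>\<open>1 + l i\<close> is the value of the form of \<open>P + H\<close> at
    column \<open>i\<close> of the invertible matrix \<open>B\<close>.\<close>
  have pos: "0 < 1 + l i" for i
  proof -
    have "C *v (B *v axis i 1) = axis i 1"
      by (simp add: matrix_vector_mul_assoc C)
    then have "B *v axis i 1 \<noteq> 0"
      by (metis axis_eq_0_iff matrix_vector_mult_0_right zero_neq_one)
    then have "0 < (B *v axis i 1) \<bullet> ((P + H) *v (B *v axis i 1))"
      by (rule pos_defD(2)[OF PH])
    also have "\<dots> = axis i 1 \<bullet> ((transpose B ** (P + 1 *\<^sub>R H) ** B) *v axis i 1)"
      by (simp only: congruence_inner scaleR_one)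
    also have "\<dots> = 1 + l i"
      unfolding diag by (simp add: inner_axis' matrix_vector_mult_basis column_def)
    finally show ?thesis .
  qed
  \<comment> \<open>\<open>D\<close> is identified by differentiating a sum of logarithms that
    agrees with \<open>ln (det (P + t H))\<close> near \<open>0\<close>, where all factors are
    positive.\<close>
  have "D = (\<Sum>i\<in>UNIV. l i)"
  proof (rule DERIV_unique[OF deriv])
    have ev: "\<forall>\<^sub>F t in nhds 0. \<forall>i. 0 < 1 + t * l i"
    proof (intro eventually_all_finite)
      fix i
      have "((\<lambda>t. 1 + t * l i) \<longlongrightarrow> 1 + 0 * l i) (nhds 0)"
        by (intro tendsto_intros filterlim_ident)
      then show "\<forall>\<^sub>F t in nhds 0. 0 < 1 + t * l i"
        by (rule order_tendstoD) simp
    qed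
    have "((\<lambda>t. ln (det P) + (\<Sum>i\<in>UNIV. ln (1 + t * l i))) has_real_derivative (\<Sum>i\<in>UNIV. l i)) (at 0)"
      by (auto intro!: derivative_eq_intros)
    then show "((\<lambda>t. ln (det (P + t *\<^sub>R H))) has_real_derivative (\<Sum>i\<in>UNIV. l i)) (at 0)"
    proof (rule DERIV_cong_ev[THEN iffD1, rotated 3])
      show "\<forall>\<^sub>F t in nhds 0. ln (det P) + (\<Sum>i\<in>UNIV. ln (1 + t * l i)) = ln (det (P + t *\<^sub>R H))"
        using ev
      proof eventually_elim
        case (elim t)
        then have "1 + t * l i \<noteq> 0" for i
          by (metis less_irrefl)
        then show ?case
          using pos_def_det_pos[OF P] by (simp add: det ln_mult ln_prod)
      qed
    qed auto
  qed
  moreover have "ln (det (P + H)) = ln (det P) + (\<Sum>i\<in>UNIV. ln (1 + l i))"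
    using det[of 1] pos_def_det_pos[OF P] pos[THEN less_imp_neq[symmetric]] by (simp add: ln_mult ln_prod)
  moreover have "(\<Sum>i\<in>UNIV. ln (1 + l i)) < (\<Sum>i\<in>UNIV. l i)"
  proof (rule sum_strict_mono_ex1)
    have "- 1 < l i" for i
      using pos[of i] by simp
    then show "\<forall>i\<in>UNIV. ln (1 + l i) \<le> l i"
      using ln_add_one_self_le_self2 by blast
    \<comment> \<open>If all \<open>l i\<close> vanished, undoing the congruence with
      \<open>C\<close>, the inverse of \<open>B\<close>, would give \<open>H = 0\<close>.\<close>
    have "\<exists>i. l i \<noteq> 0"
    proof (rule ccontr)
      assume "\<not> ?thesis"
      then have "transpose B ** H ** B = 0"
        using B(2) by (simp add: vec_eq_iff)
      moreover have "transpose C ** (transpose B ** H ** B) ** C = transpose (B ** C) ** H ** (B ** C)"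
        by (simp add: matrix_transpose_mul matrix_mul_assoc)
      ultimately have "H = 0"
        by (simp add: C)
      with \<open>H \<noteq> 0\<close> show False ..
    qed
    then obtain i where "l i \<noteq> 0" ..
    then have "ln (1 + l i) < l i"
      using pos[of i] ln_eq_minus_one[of "1 + l i"] ln_le_minus_one[of "1 + l i"] by force
    then show "\<exists>i\<in>UNIV. ln (1 + l i) < l i" by blast
  qed simp
  ultimately show ?thesis by simp
qed

section \<open>Projected gradient method with the Armijo rule\<close>

text \<open>The variational inequality of the projection, solved for \<open>g\<close>. With
  \<open>y = x\<close> it yields descent along the step, with \<open>y\<close> a minimiser it bounds
  the optimality gap.\<close>

lemma projected_step_inner_le:
  fixes x g :: "'a::euclidean_space"
  assumes "convex S" "closed S" "y \<in> S" "0 < a"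
  defines "u \<equiv> closest_point S (x - a *\<^sub>R g)"
  shows "g \<bullet> (u - y) \<le> (x - u) \<bullet> (u - y) / a"
proof -
  have "(x - a *\<^sub>R g - u) \<bullet> (y - u) \<le> 0"
    unfolding u_def by (intro closest_point_dot assms)
  then have "a * (g \<bullet> (u - y)) \<le> (x - u) \<bullet> (u - y)"
    by (simp add: inner_diff_left inner_diff_right algebra_simps)
  then show ?thesis
    using \<open>0 < a\<close> by (simp add: field_simps)
qed

text \<open>With weights \<open>b\<close> and \<open>a\<close> the terms in \<open>g\<close> cancel
  from the sum of the two variational inequalities. Cauchy-Schwarz then gives
  \<open>(b |U| - a |V|) (|U| - |V|) <= 0\<close>, and \<open>a <= b\<close> excludes
  \<open>a |V| > b |U|\<close>.\<close>

lemma projected_step_ratio: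
  fixes x g :: "'a::euclidean_space"
  assumes S: "convex S" "closed S" "S \<noteq> {}" and "0 < a" "a \<le> b"
  defines "u \<equiv> closest_point S (x - a *\<^sub>R g)" and "v \<equiv> closest_point S (x - b *\<^sub>R g)"
  shows "a * norm (v - x) \<le> b * norm (u - x)"
proof -
  define U V where "U = u - x" and "V = v - x"
  have "u \<in> S" "v \<in> S"
    unfolding u_def v_def using S by (auto intro: closest_point_in_set)
  then have "b * ((x - a *\<^sub>R g - u) \<bullet> (v - u)) + a * ((x - b *\<^sub>R g - v) \<bullet> (u - v)) \<le> 0"
    unfolding u_def v_def using assms closest_point_dot[OF S(1,2)]
    by (intro add_nonpos_nonpos mult_nonneg_nonpos) auto
  also have "b * ((x - a *\<^sub>R g - u) \<bullet> (v - u)) + a * ((x - b *\<^sub>R g - v) \<bullet> (u - v))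
      = b * (U \<bullet> U) - (a + b) * (U \<bullet> V) + a * (V \<bullet> V)"
    unfolding U_def V_def
    by (simp add: inner_diff_left inner_diff_right inner_commute algebra_simps)
  finally have "b * (norm U)\<^sup>2 + a * (norm V)\<^sup>2 \<le> (a + b) * (U \<bullet> V)"
    by (simp add: power2_norm_eq_inner)
  also have "\<dots> \<le> (a + b) * (norm U * norm V)"
    using assms norm_cauchy_schwarz[of U V] by (intro mult_left_mono) auto
  finally have "(b * norm U - a * norm V) * (norm U - norm V) \<le> 0"
    by (simp add: algebra_simps power2_eq_square)
  moreover have "a * norm V \<le> b * norm U" if "norm V \<le> norm U"
    using that assms by (intro mult_mono) auto
  ultimately show ?thesis
    unfolding U_def[symmetric] V_def[symmetric] by (smt (verit) mult_neg_neg)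
qed

text \<open>At a point \<open>z\<close> strictly between two distinct minimisers the strict gradient
  inequalities average to \<open>f z < f q\<close>. As \<open>X\<close> is only known to be open,
  \<open>z\<close> is taken so close to \<open>q\<close> that it stays in \<open>X\<close>.\<close>

lemma unique_minimiser_of_strict_gradient_inequality:
  fixes f :: "'a::real_inner \<Rightarrow> real"
  assumes S: "convex S" and X: "open X"
    and grad: "\<And>x y. x \<in> S \<inter> X \<Longrightarrow> y \<in> S \<inter> X \<Longrightarrow> x \<noteq> y \<Longrightarrow> f x + g x \<bullet> (y - x) < f y"
    and q: "q \<in> S \<inter> X" "\<And>y. y \<in> S \<inter> X \<Longrightarrow> f q \<le> f y"
    and p: "p \<in> S \<inter> X" "f p \<le> f q"
  shows "p = q"
proof (rule ccontr)
  assume "p \<noteq> q"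
  obtain e where "0 < e" "ball q e \<subseteq> X"
    using X q(1) open_contains_ball by blast
  define t where "t = min (1 / 2) (e / (2 * norm (p - q)))"
  define z where "z = (1 - t) *\<^sub>R q + t *\<^sub>R p"
  have t: "0 < t" "t < 1" "t * norm (p - q) < e"
    using \<open>p \<noteq> q\<close> \<open>0 < e\<close> by (auto simp: t_def min_def field_simps)
  have zq: "z - q = t *\<^sub>R (p - q)" "z - p = (1 - t) *\<^sub>R (q - p)"
    by (simp_all add: z_def algebra_simps)
  have "z \<in> S"
    unfolding z_def using S p q t by (intro convexD) auto
  moreover have "z \<in> X"
    using \<open>ball q e \<subseteq> X\<close> zq(1) t by (auto simp: dist_norm norm_minus_commute subset_iff)
  ultimately have z: "z \<in> S \<inter> X" by blast
  have "z \<noteq> q" "z \<noteq> p"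
    using zq t \<open>p \<noteq> q\<close> by (metis diff_self scaleR_eq_0_iff right_minus_eq less_irrefl)+
  then have "f z + g z \<bullet> (q - z) < f q" "f z + g z \<bullet> (p - z) < f p"
    using grad z p q by auto
  then have "(1 - t) * (f z + g z \<bullet> (q - z)) + t * (f z + g z \<bullet> (p - z)) < (1 - t) * f q + t * f p"
    using t by (intro add_strict_mono mult_strict_left_mono) auto
  also have "\<dots> \<le> f q"
    using p(2) t mult_left_mono[of "f p" "f q" t] by (simp add: algebra_simps)
  also have "(1 - t) * (f z + g z \<bullet> (q - z)) + t * (f z + g z \<bullet> (p - z))
      = f z + g z \<bullet> ((1 - t) *\<^sub>R (q - z) + t *\<^sub>R (p - z))"
    by (simp add: inner_add_right algebra_simps)
  also have "(1 - t) *\<^sub>R (q - z) + t *\<^sub>R (p - z) = 0"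
    by (simp add: z_def algebra_simps)
  finally show False
    using q(2)[OF z] by simp
qed

text \<open>\<open>g\<close> stands for the gradient and is linked to \<open>f\<close> by the strict
  inequality. Closedness of the initial sublevel set makes it compact, which keeps the iterates away
  from the boundary of \<open>X\<close>.\<close>

theorem projected_gradient_armijo_converges:
  fixes S X :: "'a::euclidean_space set" and f :: "'a \<Rightarrow> real" and g :: "'a \<Rightarrow> 'a"
  defines "T \<equiv> \<lambda>p a. closest_point S (p - a *\<^sub>R g p)"
  assumes S: "compact S" "convex S" and X: "open X"
    and f: "continuous_on (S \<inter> X) f" and g: "continuous_on (S \<inter> X) g"
    and grad: "\<And>x y. x \<in> S \<inter> X \<Longrightarrow> y \<in> S \<inter> X \<Longrightarrow> x \<noteq> y \<Longrightarrow> f x + g x \<bullet> (y - x) < f y"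
    and params: "0 < \<sigma>" "\<sigma> < 1" "0 < \<rho>" "\<rho> < 1" "0 < \<alpha>"
    and x0: "x 0 \<in> S \<inter> X" and level: "closed {y \<in> S \<inter> X. f y \<le> f (x 0)}"
  defines "accepted \<equiv> \<lambda>p a. T p a \<in> X \<and> f (T p a) \<le> f p + \<sigma> * (g p \<bullet> (T p a - p))"
  assumes step: "\<And>k. \<exists>m. x (Suc k) = T (x k) (\<rho> ^ m * \<alpha>) \<and> accepted (x k) (\<rho> ^ m * \<alpha>)
      \<and> (\<forall>j<m. \<not> accepted (x k) (\<rho> ^ j * \<alpha>))"
  obtains q where "q \<in> S \<inter> X" "\<And>y. y \<in> S \<inter> X \<Longrightarrow> f q \<le> f y" "x \<longlonglongrightarrow> q"
proof -
  define L where "L = {y \<in> S \<inter> X. f y \<le> f (x 0)}"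
  have cl: "closed S"
    using S by (simp add: compact_imp_closed)
  have "S \<noteq> {}"
    using x0 by auto
  have T_in: "T p a \<in> S" for p a
    unfolding T_def by (rule closest_point_in_set[OF cl \<open>S \<noteq> {}\<close>])
  have L_sub: "L \<subseteq> S \<inter> X"
    by (auto simp: L_def)
  have "compact L"
    using compact_Int_closed[OF S(1) level] L_sub by (simp add: L_def Int_absorb1)
  have contL: "continuous_on L f" "continuous_on L g"
    using f g L_sub continuous_on_subset by blast+
  have "x 0 \<in> L"
    using x0 by (simp add: L_def)
  then obtain q where q: "q \<in> L" "\<And>y. y \<in> L \<Longrightarrow> f q \<le> f y"
    using continuous_attains_inf[OF \<open>compact L\<close> _ contL(1)] by blast
  have q_in: "q \<in> S \<inter> X"
    using q(1) L_sub by blast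
  have q_min: "f q \<le> f y" if "y \<in> S \<inter> X" for y
    using q that by (force simp: L_def)

  have step_T: "g p \<bullet> (T p a - y) \<le> (p - T p a) \<bullet> (T p a - y) / a" if "0 < a" "y \<in> S" for p a y
    unfolding T_def by (intro projected_step_inner_le S cl that)
  then have step_self: "(norm (T p a - p))\<^sup>2 / a \<le> - (g p \<bullet> (T p a - p))" if "0 < a" "p \<in> S" for p a
    using step_T[OF that, of p]
    by (simp add: power2_norm_eq_inner inner_diff_left inner_diff_right inner_commute diff_divide_distrib algebra_simps)

  obtain m where m: "\<And>k. x (Suc k) = T (x k) (\<rho> ^ m k * \<alpha>)" "\<And>k. accepted (x k) (\<rho> ^ m k * \<alpha>)"
      "\<And>k j. j < m k \<Longrightarrow> \<not> accepted (x k) (\<rho> ^ j * \<alpha>)"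
    using step by metis
  have a_pos: "0 < \<rho> ^ j * \<alpha>" and a_le: "\<rho> ^ j * \<alpha> \<le> \<alpha>" for j
    using params power_le_one[of \<rho> j] by (auto simp: mult_le_cancel_right1)
  have desc: "f (x (Suc k)) \<le> f (x k) + \<sigma> * (g (x k) \<bullet> (x (Suc k) - x k))" "x (Suc k) \<in> X" for k
    using m(2)[of k] by (simp_all add: accepted_def m(1)[symmetric])
  have inner_nonpos: "g (x k) \<bullet> (x (Suc k) - x k) \<le> - ((norm (x (Suc k) - x k))\<^sup>2 / \<alpha>)" if "x k \<in> S" for k
  proof -
    have "(norm (x (Suc k) - x k))\<^sup>2 / \<alpha> \<le> (norm (x (Suc k) - x k))\<^sup>2 / (\<rho> ^ m k * \<alpha>)"
      using a_pos a_le by (intro divide_left_mono) (auto intro: mult_pos_pos params)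
    also have "\<dots> \<le> - (g (x k) \<bullet> (x (Suc k) - x k))"
      using step_self[OF a_pos that] by (simp add: m(1))
    finally show ?thesis by simp
  qed
  have x_S: "x k \<in> S" for k
    by (cases k) (use x0 m(1) T_in in auto)
  have f_dec: "f (x (Suc k)) \<le> f (x k)" for k
  proof -
    have "g (x k) \<bullet> (x (Suc k) - x k) \<le> 0"
      using inner_nonpos[OF x_S[of k]] params(5) by (smt (verit) divide_nonneg_pos zero_le_power2)
    then show ?thesis
      using desc(1)[of k] params(1) by (smt (verit) mult_pos_pos mult_nonneg_nonpos)
  qed
  have x_L: "x k \<in> L" for k
  proof (induction k)
    case (Suc k)
    then show ?case
      using x_S[of "Suc k"] desc(2)[of k] f_dec[of k] by (auto simp: L_def)
  qed (fact \<open>x 0 \<in> L\<close>)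

  define d where "d k = norm (x (Suc k) - x k)" for k
  \<comment> \<open>The values \<open>f (x k)\<close> decrease and are bounded below by
    \<open>f q\<close>, so their differences tend to \<open>0\<close>; times
    \<open>\<alpha> / \<sigma>\<close> these dominate the squared step lengths.\<close>
  have d_lim: "d \<longlonglongrightarrow> 0"
  proof -
    have "decseq (\<lambda>k. f (x k))"
      using f_dec by (rule decseq_SucI)
    then obtain l where "(\<lambda>k. f (x k)) \<longlonglongrightarrow> l"
      using decseq_convergent[of "\<lambda>k. f (x k)" "f q"] q(2) x_L by metis
    then have "(\<lambda>k. f (x k) - f (x (Suc k))) \<longlonglongrightarrow> l - l"
      by (intro tendsto_diff LIMSEQ_Suc)
    then have "(\<lambda>k. (\<alpha> / \<sigma>) * (f (x k) - f (x (Suc k)))) \<longlonglongrightarrow> (\<alpha> / \<sigma>) * (l - l)"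
      by (intro tendsto_mult tendsto_const)
    then have lim: "(\<lambda>k. (\<alpha> / \<sigma>) * (f (x k) - f (x (Suc k)))) \<longlonglongrightarrow> 0"
      by simp
    have "(\<lambda>k. (d k)\<^sup>2) \<longlonglongrightarrow> 0"
    proof (rule tendsto_sandwich[OF _ _ tendsto_const lim])
      have "(d k)\<^sup>2 \<le> (\<alpha> / \<sigma>) * (f (x k) - f (x (Suc k)))" for k
      proof -
        have "\<sigma> * ((d k)\<^sup>2 / \<alpha>) \<le> - (\<sigma> * (g (x k) \<bullet> (x (Suc k) - x k)))"
          using mult_left_mono[OF inner_nonpos[OF x_S[of k]], of \<sigma>] params(1) by (simp add: d_def)
        also have "\<dots> \<le> f (x k) - f (x (Suc k))"
          using desc(1)[of k] by simp
        finally show ?thesis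
          using params by (simp add: field_simps)
      qed
      then show "\<forall>\<^sub>F k in sequentially. (d k)\<^sup>2 \<le> (\<alpha> / \<sigma>) * (f (x k) - f (x (Suc k)))"
        by simp
    qed simp
    then have "(\<lambda>k. sqrt ((d k)\<^sup>2)) \<longlonglongrightarrow> sqrt 0"
      by (rule tendsto_real_sqrt)
    then show ?thesis
      by (simp add: d_def[abs_def])
  qed

  \<comment> \<open>A rejected trial point may lie outside \<open>L\<close> and even outside
    \<open>X\<close>, so continuity on \<open>L\<close> does not suffice. \<open>K\<close> is a
    compact neighbourhood of \<open>L\<close> in \<open>S\<close>; the radius \<open>e / 2\<close>
    keeps it inside the \<open>e\<close>-balls and thus inside \<open>X\<close>.\<close>
  have unif: "\<exists>\<delta>>0. \<forall>y\<in>L. \<forall>z\<in>S. norm (z - y) < \<delta> \<longrightarrow> z \<in> X \<and> norm (g z - g y) < \<eta>" if eta: "0 < \<eta>" for \<eta>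
  proof -
    obtain e where e: "0 < e" "(\<Union>y\<in>L. ball y e) \<subseteq> X"
      using compact_subset_open_imp_ball_epsilon_subset[OF \<open>compact L\<close> X] L_sub by blast
    define K where "K = {y + v |y v. y \<in> L \<and> v \<in> cball 0 (e / 2)} \<inter> S"
    have "compact K"
      unfolding K_def by (intro compact_Int_closed compact_sums \<open>compact L\<close> compact_cball cl)
    have "K \<subseteq> X"
    proof
      fix w assume "w \<in> K"
      then obtain y v where "y \<in> L" "norm v \<le> e / 2" "w = y + v"
        by (auto simp: K_def)
      then have "w \<in> ball y e"
        using e(1) by (simp add: dist_norm)
      with \<open>y \<in> L\<close> e(2) show "w \<in> X" by blast
    qed
    then have "continuous_on K g"
      by (intro continuous_on_subset[OF g]) (auto simp: K_def)
    then have "uniformly_continuous_on K g"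
      using \<open>compact K\<close> by (rule compact_uniformly_continuous)
    then obtain \<delta> where \<delta>: "0 < \<delta>" "\<And>y z. y \<in> K \<Longrightarrow> z \<in> K \<Longrightarrow> dist z y < \<delta> \<Longrightarrow> dist (g z) (g y) < \<eta>"
      using eta unfolding uniformly_continuous_on_def by blast
    show ?thesis
    proof (intro exI[of _ "min \<delta> (e / 2)"] conjI ballI impI)
      fix y z assume yz: "y \<in> L" "z \<in> S" "norm (z - y) < min \<delta> (e / 2)"
      have K_I: "y + v \<in> K" if "norm v \<le> e / 2" "y + v \<in> S" for v
        using that yz(1) by (auto simp: K_def)
      have "y \<in> K" "z \<in> K"
        using K_I[of 0] K_I[of "z - y"] yz e(1) L_sub by auto
      then show "z \<in> X" "norm (g z - g y) < \<eta>"
        using \<open>K \<subseteq> X\<close> \<delta>(2) yz(3) by (auto simp: dist_norm)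
    qed (use \<delta>(1) e(1) in simp)
  qed

  txt \<open>The trial step \<open>b k\<close> is the accepted one if that is \<open>\<alpha>\<close>, and the last rejected one otherwise; in
    both cases the length of the step is small compared to \<open>b k\<close>.\<close>
  define b where "b k = \<rho> ^ (m k - 1) * \<alpha>" for k
  define z where "z k = T (x k) (b k)" for k
  define R where "R k = norm (z k - x k) / b k" for k
  have b_pos: "0 < b k" and b_le: "b k \<le> \<alpha>" for k
    using a_pos a_le by (simp_all add: b_def)
  \<comment> \<open>After a rejection the accepted step size is \<open>\<rho> * b k\<close>, and the
    ratio inequality compares the two projected steps; without rejection \<open>z k\<close> is the
    next iterate.\<close>
  have z_close: "\<rho> * norm (z k - x k) \<le> d k" for k
  proof (cases "m k")
    case 0
    then have "z k = x (Suc k)"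
      by (simp add: z_def b_def m(1))
    then show ?thesis
      using params mult_right_mono[of \<rho> 1 "d k"] by (simp add: d_def)
  next
    case (Suc j)
    have "(\<rho> * b k) * norm (z k - x k) \<le> b k * norm (x (Suc k) - x k)"
      unfolding z_def m(1)[of k] T_def Suc b_def
      using params projected_step_ratio[OF S(2) cl \<open>S \<noteq> {}\<close>, of "\<rho> * (\<rho> ^ j * \<alpha>)" "\<rho> ^ j * \<alpha>" "x k" "g (x k)"]
        a_pos[of j] by (simp add: mult.assoc)
    then show ?thesis
      using b_pos[of k] by (simp add: d_def mult.assoc mult.left_commute)
  qed
  have R_lim: "R \<longlonglongrightarrow> 0"
  proof (rule LIMSEQ_I)
    fix r :: real assume "0 < r"
    then have "0 < r * (1 - \<sigma>)"
      using params by simp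
    from unif[OF this] obtain \<delta> where \<delta>: "0 < \<delta>"
      "\<And>y z. y \<in> L \<Longrightarrow> z \<in> S \<Longrightarrow> norm (z - y) < \<delta> \<Longrightarrow> z \<in> X \<and> norm (g z - g y) < r * (1 - \<sigma>)"
      by blast
    \<comment> \<open>The first bound serves an accepted \<open>\<alpha>\<close>, where
      \<open>R k = d k / \<alpha>\<close>; the second brings \<open>z k\<close> within
      \<open>\<delta>\<close> of \<open>x k\<close> after a rejection.\<close>
    have "\<forall>\<^sub>F k in sequentially. d k < min (r * \<alpha>) (\<delta> * \<rho>)"
      using d_lim \<open>0 < r\<close> \<delta>(1) params by (intro order_tendstoD) auto
    then have "\<forall>\<^sub>F k in sequentially. R k < r"
    proof eventually_elim
      case (elim k)
      show ?case
      proof (cases "m k")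
        case 0
        then have "z k = x (Suc k)" "b k = \<alpha>"
          by (simp_all add: z_def b_def m(1))
        then show ?thesis
          using elim params by (simp add: R_def d_def field_simps)
      next
        case (Suc j)
        have "norm (z k - x k) < \<delta>"
          using z_close[of k] elim params by (smt (verit) mult.commute mult_less_cancel_right_pos)
        then have zX: "z k \<in> X" and gz: "norm (g (z k) - g (x k)) < r * (1 - \<sigma>)"
          using \<delta>(2)[OF x_L] T_in by (auto simp: z_def)
        have "\<not> accepted (x k) (b k)"
          using m(3)[of j k] Suc by (simp add: b_def)
        then have "f (x k) + \<sigma> * (g (x k) \<bullet> (z k - x k)) < f (z k)"
          using zX by (simp add: accepted_def z_def)
        moreover from this have "z k \<noteq> x k" by auto
        \<comment> \<open>This bounds \<open>f (z k) - f (x k)\<close> above by the slope at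
          \<open>z k\<close>, while rejection bounds it below by the fraction
          \<open>\<sigma>\<close> of the slope at \<open>x k\<close>; the gap between the slopes is
          controlled by the change of \<open>g\<close>.\<close>
        moreover have "f (z k) + g (z k) \<bullet> (x k - z k) < f (x k)"
          using \<open>z k \<noteq> x k\<close> zX T_in x_L L_sub by (intro grad) (auto simp: z_def)
        ultimately have "(1 - \<sigma>) * - (g (x k) \<bullet> (z k - x k)) < (g (z k) - g (x k)) \<bullet> (z k - x k)"
          by (simp add: inner_diff_left inner_diff_right algebra_simps)
        also have "\<dots> \<le> norm (g (z k) - g (x k)) * norm (z k - x k)"
          by (rule norm_cauchy_schwarz)
        also have "\<dots> \<le> r * (1 - \<sigma>) * norm (z k - x k)"
          using gz by (intro mult_right_mono) auto
        also have "\<dots> = (1 - \<sigma>) * (r * norm (z k - x k))"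
          by simp
        finally have "- (g (x k) \<bullet> (z k - x k)) < r * norm (z k - x k)"
          using params by (simp only: mult_less_cancel_left_pos diff_gt_0_iff_gt)
        then have "(norm (z k - x k))\<^sup>2 / b k < r * norm (z k - x k)"
          using step_self[OF b_pos[of k] x_S[of k]] by (simp add: z_def)
        then have "R k * norm (z k - x k) < r * norm (z k - x k)"
          by (simp only: R_def power2_eq_square times_divide_eq_left)
        then show ?thesis
          by (rule mult_right_less_imp_less) simp
      qed
    qed
    then show "\<exists>N. \<forall>k\<ge>N. norm (R k - 0) < r"
      using b_pos by (auto simp: eventually_sequentially R_def less_imp_le)
  qed

  have f_lim: "(\<lambda>k. f (x k)) \<longlonglongrightarrow> f q"
  proof -
    obtain G where G: "\<And>y. y \<in> L \<Longrightarrow> norm (g y) \<le> G"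
      using compact_imp_bounded[OF compact_continuous_image[OF contL(2) \<open>compact L\<close>]]
      by (auto simp: bounded_iff)
    obtain M where M: "\<And>y. y \<in> S \<Longrightarrow> norm y \<le> M"
      using compact_imp_bounded[OF S(1)] by (auto simp: bounded_iff)
    \<comment> \<open>The gap is split at \<open>z k\<close>: the first part is at most
      \<open>G\<close> times the length \<open>R k * b k\<close>, the second is covered by the
      projection inequality, and both carry the factor \<open>R k\<close>.\<close>
    have bound: "f (x k) - f q \<le> R k * (G * \<alpha> + 2 * M)" for k
    proof -
      have zR: "norm (z k - x k) = R k * b k"
        using b_pos[of k] by (simp add: R_def)
      have "f (x k) - f q \<le> g (x k) \<bullet> (x k - q)"
      proof (cases "x k = q")
        case False
        have "x k \<in> S \<inter> X"
          using x_L L_sub by blast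
        from grad[OF this q_in False] show ?thesis
          by (simp add: inner_diff_right)
      qed simp
      also have "\<dots> = g (x k) \<bullet> (x k - z k) + g (x k) \<bullet> (z k - q)"
        by (simp add: inner_diff_right)
      also have "g (x k) \<bullet> (x k - z k) \<le> norm (g (x k)) * norm (z k - x k)"
        using norm_cauchy_schwarz[of "g (x k)" "x k - z k"] by (simp add: norm_minus_commute)
      also have "\<dots> \<le> G * (R k * \<alpha>)"
        unfolding zR using G[OF x_L[of k]] b_pos[of k] b_le[of k]
        by (intro mult_mono mult_left_mono) (auto simp: R_def intro: order_trans[OF norm_ge_zero])
      also have "g (x k) \<bullet> (z k - q) \<le> (x k - z k) \<bullet> (z k - q) / b k"
        using step_T[OF b_pos, of q "x k" k] q_in by (simp add: z_def)
      also have "\<dots> \<le> norm (x k - z k) * norm (z k - q) / b k"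
        using b_pos[of k] norm_cauchy_schwarz by (intro divide_right_mono) (auto simp: less_imp_le)
      also have "\<dots> = R k * norm (z k - q)"
        by (simp add: R_def norm_minus_commute)
      also have "\<dots> \<le> R k * (2 * M)"
        using M[of "z k"] M[of q] norm_triangle_ineq4[of "z k" q] T_in q_in b_pos[of k]
        by (intro mult_left_mono) (auto simp: R_def z_def)
      finally show ?thesis
        by (simp add: algebra_simps)
    qed
    have "(\<lambda>k. R k * (G * \<alpha> + 2 * M)) \<longlonglongrightarrow> 0 * (G * \<alpha> + 2 * M)"
      by (intro tendsto_intros R_lim)
    then have "(\<lambda>k. R k * (G * \<alpha> + 2 * M)) \<longlonglongrightarrow> 0"
      by simp
    then have "(\<lambda>k. f (x k) - f q) \<longlonglongrightarrow> 0"
    proof (rule tendsto_sandwich[rotated 3])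
      show "\<forall>\<^sub>F k in sequentially. 0 \<le> f (x k) - f q"
        using q(2)[OF x_L] by simp
      show "\<forall>\<^sub>F k in sequentially. f (x k) - f q \<le> R k * (G * \<alpha> + 2 * M)"
        using bound by simp
    qed simp
    then show ?thesis
      by (simp add: LIM_zero_iff)
  qed

  \<comment> \<open>If \<open>L - U\<close> is nonempty, the minimum of \<open>f\<close> over this
    compact set exceeds \<open>f q\<close> by uniqueness of the minimiser, so the convergence of the
    values forces the iterates into \<open>U\<close>.\<close>
  have "x \<longlonglongrightarrow> q"
  proof (rule topological_tendstoI)
    fix U assume U: "open U" "q \<in> U"
    show "\<forall>\<^sub>F k in sequentially. x k \<in> U"
    proof (cases "L - U = {}")
      case True
      then have "x k \<in> U" for k
        using x_L by blast
      then show ?thesis by simp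
    next
      case False
      have "compact (L - U)"
        using \<open>compact L\<close> U(1) by (rule compact_diff)
      then obtain p where p: "p \<in> L - U" "\<And>y. y \<in> L - U \<Longrightarrow> f p \<le> f y"
        using continuous_attains_inf[of "L - U" f] False contL(1) continuous_on_subset
        by (metis Diff_subset)
      have "f q < f p"
        using unique_minimiser_of_strict_gradient_inequality[OF S(2) X grad q_in q_min, of p] p(1) U(2) L_sub
        by fastforce
      then have "\<forall>\<^sub>F k in sequentially. f (x k) < f p"
        using f_lim by (rule order_tendstoD(2)[rotated])
      then show ?thesis
        by eventually_elim (use p(2) x_L in force)
    qed
  qed
  then show thesis
    using that q_in q_min by blast
qed

section \<open>Application to the controllability Gramian\<close>

lemma W_con_entry: "W_con A p $ a $ b = (\<Sum>i\<in>UNIV. p $ i * gramian A i $ a $ b)"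
  by (simp add: W_con_def sum_component)

lemma W_con_add: "W_con A (p + q) = W_con A p + W_con A q"
  by (simp add: vec_eq_iff W_con_entry distrib_right sum.distrib)

lemma W_con_scaleR: "W_con A (c *\<^sub>R p) = c *\<^sub>R W_con A p"
  by (simp add: vec_eq_iff W_con_entry sum_distrib_left mult.assoc)

lemma transpose_W_con:
  assumes "stable_matrix A"
  shows "transpose (W_con A p) = W_con A p"
  using transpose_gramian[OF assms] by (simp add: vec_eq_iff transpose_def W_con_entry)

lemma W_con_quadratic_form:
  "x \<bullet> (W_con A p *v x) = (\<Sum>i\<in>UNIV. p $ i * (x \<bullet> (gramian A i *v x)))"
proof -
  have "W_con A p *v x = (\<Sum>i\<in>UNIV. p $ i *\<^sub>R (gramian A i *v x))"
    unfolding W_con_def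
    by (simp add: vec_eq_iff matrix_vector_mult_def sum_component sum_distrib_left sum_distrib_right mult.assoc)
      (intro allI sum.swap)
  then show ?thesis
    by (simp add: inner_sum_right)
qed

lemma W_con_psd:
  assumes "stable_matrix A" "\<And>i. 0 \<le> p $ i"
  shows "0 \<le> x \<bullet> (W_con A p *v x)"
  unfolding W_con_quadratic_form using assms gramian_psd by (intro sum_nonneg mult_nonneg_nonneg)

text \<open>Linearity sums the equations of the single Gramians. The right-hand side displays
  \<open>p\<close> itself, whence injectivity and, for positive \<open>p\<close>,
  definiteness.\<close>

lemma W_con_lyapunov:
  assumes "stable_matrix A"
  shows "A ** W_con A p + W_con A p ** transpose A = (\<chi> a b. if a = b then - p $ a else 0)"
proof -
  have "(A ** W_con A p + W_con A p ** transpose A) $ a $ b = (if a = b then - p $ a else 0)" for a b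
  proof -
    have "(A ** W_con A p) $ a $ b = (\<Sum>i\<in>UNIV. p $ i * (A ** gramian A i) $ a $ b)"
      by (simp add: matrix_matrix_mult_def W_con_entry sum_distrib_left mult.left_commute) (rule sum.swap)
    moreover have "(W_con A p ** transpose A) $ a $ b = (\<Sum>i\<in>UNIV. p $ i * (gramian A i ** transpose A) $ a $ b)"
      by (simp add: matrix_matrix_mult_def W_con_entry sum_distrib_left sum_distrib_right mult.assoc) (rule sum.swap)
    ultimately have "(A ** W_con A p + W_con A p ** transpose A) $ a $ b
        = (\<Sum>i\<in>UNIV. p $ i * (A ** gramian A i + gramian A i ** transpose A) $ a $ b)"
      by (simp add: distrib_left sum.distrib)
    also have "\<dots> = (\<Sum>i\<in>UNIV. if i = a then if a = b then - p $ a else 0 else 0)"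
      unfolding gramian_lyapunov[OF assms] by (intro sum.cong) (auto simp: outer_prod_def axis_def)
    finally show ?thesis by simp
  qed
  then show ?thesis
    by (simp add: vec_eq_iff)
qed

lemma W_con_eq_0_imp:
  assumes "stable_matrix A" "W_con A p = 0"
  shows "p = 0"
proof -
  have "(if a = b then - p $ a else 0) = 0" for a b
    using W_con_lyapunov[OF assms(1), of p] assms(2) by (simp add: vec_eq_iff matrix_matrix_mult_def)
  from this[of a a for a] show ?thesis
    by (simp add: vec_eq_iff)
qed

text \<open>Were the semidefinite form to vanish at \<open>x\<close>, then \<open>x\<close> would
  lie in the kernel. Testing the Lyapunov equation with \<open>x\<close> gives \<open>0\<close> on
  the left and minus the sum of the \<open>p $ i * (x $ i)\<^sup>2\<close> on the right.\<close>

lemma W_con_pos_def: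
  fixes A :: "real^'n^'n"
  assumes A: "stable_matrix A" and p: "\<And>i. 0 < p $ i"
  shows "pos_def (W_con A p)"
  unfolding pos_def_def
proof (intro conjI allI impI)
  show sym: "transpose (W_con A p) = W_con A p"
    by (rule transpose_W_con[OF A])
  fix x :: "real^'n" assume "x \<noteq> 0"
  have psd: "0 \<le> y \<bullet> (W_con A p *v y)" for y
    using W_con_psd[OF A] p less_imp_le by blast
  show "0 < x \<bullet> (W_con A p *v x)"
  proof (rule ccontr)
    assume "\<not> ?thesis"
    then have "x \<bullet> (W_con A p *v x) = 0"
      using psd[of x] by simp
    then have orth: "y \<bullet> (W_con A p *v x) = 0" for y
      using psd_form_zero_imp[OF sym subspace_UNIV, of x y] psd by simp
    then have "W_con A p *v x = 0"
      by (metis inner_eq_zero_iff)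
    then have "x \<bullet> (A *v (W_con A p *v x)) + x \<bullet> (W_con A p *v (transpose A *v x)) = 0"
      using symmetric_matrix_inner[OF sym, of x "transpose A *v x"] by simp
    then have "x \<bullet> ((A ** W_con A p + W_con A p ** transpose A) *v x) = 0"
      by (simp only: matrix_vector_mult_add_rdistrib matrix_vector_mul_assoc inner_add_right)
    moreover have "(A ** W_con A p + W_con A p ** transpose A) *v x = (\<chi> i. - p $ i * x $ i)"
      unfolding W_con_lyapunov[OF A]
      by (simp add: vec_eq_iff matrix_vector_mult_def if_distrib[of "\<lambda>c. c * _"] cong: if_cong)
    ultimately have "(\<Sum>i\<in>UNIV. p $ i * (x $ i)\<^sup>2) = 0"
      by (simp add: inner_vec_def sum_negf power2_eq_square mult.left_commute)
    moreover have "0 \<le> p $ i * (x $ i)\<^sup>2" for i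
      using p[of i] by simp
    ultimately have "p $ i * (x $ i)\<^sup>2 = 0" for i
      by (simp add: sum_nonneg_eq_0_iff)
    then have "x $ i = 0" for i
      using p[of i] by (metis less_irrefl mult_eq_0_iff power_not_zero)
    then show False
      using \<open>x \<noteq> 0\<close> by (simp add: vec_eq_iff)
  qed
qed

section \<open>Smoothness of the determinant and the gradient of the objective\<close>

definition has_continuous_gradient :: "('a::real_inner \<Rightarrow> real) \<Rightarrow> bool" where
  "has_continuous_gradient h \<longleftrightarrow> (\<exists>d. continuous_on UNIV d \<and> (\<forall>x. GDERIV h x :> d x))"

lemma GDERIV_imp_isCont: "GDERIV h x :> d \<Longrightarrow> isCont h x"
  unfolding gderiv_def by (rule has_derivative_continuous)

lemma has_continuous_gradient_imp_continuous:
  "has_continuous_gradient h \<Longrightarrow> continuous_on S h"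
  unfolding has_continuous_gradient_def by (meson GDERIV_imp_isCont continuous_at_imp_continuous_on)

lemma has_continuous_gradient_const: "has_continuous_gradient (\<lambda>x. c)"
  unfolding has_continuous_gradient_def by (intro exI[of _ "\<lambda>x. 0"]) (simp add: GDERIV_const)

lemma has_continuous_gradient_component: "has_continuous_gradient (\<lambda>x::real^'n. x $ i)"
  unfolding has_continuous_gradient_def gderiv_def
  by (intro exI[of _ "\<lambda>x. axis i 1"])
    (auto simp: inner_axis intro!: bounded_linear_imp_has_derivative bounded_linear_vec_nth)

lemma has_continuous_gradient_add:
  assumes "has_continuous_gradient h" "has_continuous_gradient k"
  shows "has_continuous_gradient (\<lambda>x. h x + k x)"
proof -
  obtain d e where "continuous_on UNIV d" "\<And>x. GDERIV h x :> d x" "continuous_on UNIV e" "\<And>x. GDERIV k x :> e x"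
    using assms unfolding has_continuous_gradient_def by blast
  then show ?thesis
    unfolding has_continuous_gradient_def
    by (intro exI[of _ "\<lambda>x. d x + e x"]) (auto intro: continuous_on_add GDERIV_add)
qed

lemma has_continuous_gradient_mult:
  assumes "has_continuous_gradient h" "has_continuous_gradient k"
  shows "has_continuous_gradient (\<lambda>x. h x * k x)"
proof -
  obtain d e where "continuous_on UNIV d" "\<And>x. GDERIV h x :> d x" "continuous_on UNIV e" "\<And>x. GDERIV k x :> e x"
    using assms unfolding has_continuous_gradient_def by blast
  then show ?thesis
    unfolding has_continuous_gradient_def
    using assms[THEN has_continuous_gradient_imp_continuous]
    by (intro exI[of _ "\<lambda>x. h x *\<^sub>R e x + k x *\<^sub>R d x"]) (auto intro!: continuous_intros GDERIV_mult)
qed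

lemma has_continuous_gradient_sum:
  assumes "\<And>i. i \<in> I \<Longrightarrow> has_continuous_gradient (h i)"
  shows "has_continuous_gradient (\<lambda>x. \<Sum>i\<in>I. h i x)"
  using assms by (induction I rule: infinite_finite_induct)
    (auto intro: has_continuous_gradient_const has_continuous_gradient_add)

lemma has_continuous_gradient_prod:
  assumes "\<And>i. i \<in> I \<Longrightarrow> has_continuous_gradient (h i)"
  shows "has_continuous_gradient (\<lambda>x. \<Prod>i\<in>I. h i x)"
  using assms by (induction I rule: infinite_finite_induct)
    (auto intro: has_continuous_gradient_const has_continuous_gradient_mult)

text \<open>By the Leibniz formula the determinant is a polynomial in the components of
  \<open>p\<close>, and the class is closed under sums and products.\<close>

lemma has_continuous_gradient_det_W_con: "has_continuous_gradient (\<lambda>p. det (W_con A p))"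
  unfolding det_def W_con_entry
  by (intro has_continuous_gradient_sum has_continuous_gradient_prod has_continuous_gradient_mult
      has_continuous_gradient_const has_continuous_gradient_component)

text \<open>\<open>gradient\<close> is a definite description, so its value is available only after
  uniqueness of the representing vector.\<close>

lemma gradient_eqI:
  assumes "GDERIV f x :> D"
  shows "gradient f x = D"
  unfolding gradient_def
proof (rule the_equality[where P = "\<lambda>D. GDERIV f x :> D", OF assms])
  fix E assume "GDERIV f x :> E"
  then have "(\<lambda>h. h \<bullet> E) = (\<lambda>h. h \<bullet> D)"
    using assms unfolding gderiv_def by (rule has_derivative_unique)
  then have "h \<bullet> (E - D) = 0" for h
    by (metis inner_diff_right right_minus_eq)
  then show "E = D"
    by (metis inner_eq_zero_iff right_minus_eq)
qed

lemma objective_gradient: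
  fixes A :: "real^'n^'n"
  shows "det (W_con A p) > 0 \<Longrightarrow> GDERIV (objective A) p :> gradient (objective A) p"
    and "continuous_on {p. 0 < det (W_con A p)} (gradient (objective A))"
proof -
  let ?X = "{p. 0 < det (W_con A p)}"
  obtain d where d: "continuous_on UNIV d" "\<And>p. GDERIV (\<lambda>p. det (W_con A p)) p :> d p"
    using has_continuous_gradient_det_W_con[of A] unfolding has_continuous_gradient_def by blast
  have deriv: "GDERIV (objective A) p :> (- inverse (det (W_con A p))) *\<^sub>R d p" if "p \<in> ?X" for p
    unfolding objective_def[abs_def] using that
    by (intro GDERIV_DERIV_compose[OF d(2)]) (auto intro!: derivative_eq_intros simp: field_simps)
  then have eq: "gradient (objective A) p = (- inverse (det (W_con A p))) *\<^sub>R d p" if "p \<in> ?X" for p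
    using gradient_eqI that by blast
  then show "det (W_con A p) > 0 \<Longrightarrow> GDERIV (objective A) p :> gradient (objective A) p"
    using deriv by simp
  have "continuous_on ?X (\<lambda>p. (- inverse (det (W_con A p))) *\<^sub>R d p)"
    using has_continuous_gradient_imp_continuous[OF has_continuous_gradient_det_W_con]
    by (intro continuous_intros continuous_on_subset[OF d(1)]) auto
  then show "continuous_on ?X (gradient (objective A))"
    by (rule continuous_on_eq) (simp add: eq)
qed

text \<open>Strict concavity of \<open>ln det\<close> on the segment from \<open>W_con A p\<close>
  to \<open>W_con A q\<close>, whose direction \<open>H\<close> is nonzero by injectivity; the
  derivative there comes from the chain rule.\<close>

lemma objective_strict_gradient_inequality:
  fixes A :: "real^'n^'n"
  assumes A: "stable_matrix A" and p: "p \<in> X_set A" and q: "q \<in> X_set A" and "p \<noteq> q"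
  shows "objective A p + gradient (objective A) p \<bullet> (q - p) < objective A q"
proof -
  let ?D = "gradient (objective A) p \<bullet> (q - p)"
  define H where "H = W_con A (q - p)"
  have W: "W_con A (p + t *\<^sub>R (q - p)) = W_con A p + t *\<^sub>R H" for t
    by (simp add: H_def W_con_add W_con_scaleR)
  from W[of 1] have q_eq: "W_con A q = W_con A p + H"
    by simp
  have pd: "pos_def (W_con A p)" "pos_def (W_con A p + H)"
    using p q by (simp_all add: X_set_def flip: q_eq)
  have "H \<noteq> 0"
    using W_con_eq_0_imp[OF A, of "q - p"] \<open>p \<noteq> q\<close> by (auto simp: H_def)
  have "GDERIV (objective A) p :> gradient (objective A) p"
    using objective_gradient(1) pos_def_det_pos[OF pd(1)] by blast
  then have "(objective A has_derivative (\<lambda>h. h \<bullet> gradient (objective A) p)) (at (p + 0 *\<^sub>R (q - p)))"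
    by (simp add: gderiv_def)
  moreover have "((\<lambda>t. p + t *\<^sub>R (q - p)) has_derivative (\<lambda>t. t *\<^sub>R (q - p))) (at 0)"
    by (auto intro!: derivative_eq_intros)
  ultimately have "((\<lambda>t. objective A (p + t *\<^sub>R (q - p))) has_derivative
      (\<lambda>t. (t *\<^sub>R (q - p)) \<bullet> gradient (objective A) p)) (at 0)"
    by (rule has_derivative_compose[rotated])
  then have "((\<lambda>t. objective A (p + t *\<^sub>R (q - p))) has_real_derivative ?D) (at 0)"
    by (rule has_derivative_imp_has_field_derivative) (simp add: inner_commute mult.commute)
  from DERIV_minus[OF this]
  have "((\<lambda>t. ln (det (W_con A p + t *\<^sub>R H))) has_real_derivative - ?D) (at 0)"
    by (simp add: objective_def W)
  from ln_det_strictly_concave[OF pd \<open>H \<noteq> 0\<close> this] show ?thesis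
    by (simp add: objective_def q_eq)
qed

section \<open>The simplex and its feasible part\<close>

lemma std_simplex_component_le_1:
  assumes "p \<in> std_simplex"
  shows "p $ i \<le> 1"
proof -
  have "p $ i \<le> (\<Sum>i\<in>UNIV. p $ i)"
    using assms by (intro member_le_sum) (auto simp: std_simplex_def)
  then show ?thesis
    using assms by (simp add: std_simplex_def)
qed

lemma compact_std_simplex: "compact (std_simplex :: (real^'n) set)"
proof -
  have "std_simplex = {p :: real^'n. (\<Sum>i\<in>UNIV. p $ i) = 1} \<inter> (\<Inter>i. {p. 0 \<le> p $ i})"
    by (auto simp: std_simplex_def)
  moreover have "closed \<dots>"
    by (intro closed_Int closed_INT closed_Collect_eq closed_Collect_le ballI continuous_intros)
  moreover have "(std_simplex :: (real^'n) set) \<subseteq> cbox 0 1"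
    using std_simplex_component_le_1 by (auto simp: mem_box_cart) (simp add: std_simplex_def)
  then have "bounded (std_simplex :: (real^'n) set)"
    by (rule bounded_subset[OF bounded_cbox])
  ultimately show ?thesis
    by (simp add: compact_eq_bounded_closed)
qed

lemma convex_std_simplex: "convex (std_simplex :: (real^'n) set)"
  by (auto simp: convex_def std_simplex_def sum.distrib simp flip: sum_distrib_left)

text \<open>Semidefiniteness holds on the whole simplex, so a positive determinant forces
  definiteness. The determinant condition is open by continuity alone.\<close>

lemma std_simplex_Int_X_set:
  fixes A :: "real^'n^'n"
  assumes "stable_matrix A"
  shows "std_simplex \<inter> X_set A = std_simplex \<inter> {p. 0 < det (W_con A p)}"
proof -
  have "pos_def (W_con A p)" if "p \<in> std_simplex" "0 < det (W_con A p)" for p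
    using that W_con_psd[OF assms, of p]
    by (intro psd_det_nonzero_imp_pos_def transpose_W_con assms) (auto simp: std_simplex_def)
  then show ?thesis
    by (auto simp: X_set_def intro: pos_def_det_pos)
qed

text \<open>Once the method has stopped, the current point is fixed by every projected step, so the sequence
  still obeys the step rule, with the first trial value accepted.\<close>

lemma pgm_sequence_step:
  fixes A :: "real^'n^'n"
  assumes pgm: "pgm_sequence A \<sigma> \<rho> \<alpha> 0 p" and params: "0 < \<rho>" "\<rho> < 1" "0 < \<alpha>"
    and in_S: "p 0 \<in> std_simplex"
  shows "\<exists>a. armijo_step A \<sigma> \<rho> \<alpha> (p k) a \<and> p (Suc k) = trial_point A (p k) a"
proof (cases "\<exists>j<k. p j = p (Suc j)")
  case False
  then show ?thesis
    using pgm by (auto simp: pgm_sequence_def)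
next
  case True
  define j where "j = (LEAST j. p j = p (Suc j))"
  have j: "p j = p (Suc j)" "\<And>i. i < j \<Longrightarrow> p i \<noteq> p (Suc i)"
    unfolding j_def using True by (auto intro: LeastI dest: not_less_Least)
  have "j < k"
    using True unfolding j_def by (meson Least_le le_less_trans)
  \<comment> \<open>Before the first repetition the method with tolerance \<open>0\<close> has not
    stopped, so the step at \<open>j\<close> is a genuine Armijo step that returns
    \<open>p j\<close>.\<close>
  have "\<not> (\<exists>i<j. norm (p i - p (Suc i)) \<le> 0)"
    using j(2) by auto
  then have "\<exists>a. armijo_step A \<sigma> \<rho> \<alpha> (p j) a \<and> p (Suc j) = trial_point A (p j) a"
    using pgm unfolding pgm_sequence_def by presburger
  then obtain a where a: "armijo_step A \<sigma> \<rho> \<alpha> (p j) a" "p j = trial_point A (p j) a"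
    using j(1) by metis
  then obtain m where m: "a = \<rho> ^ m * \<alpha>" "armijo_cond A \<sigma> (p j) a"
    by (auto simp: armijo_step_def)
  have "0 < a" "a \<le> \<alpha>"
    using params power_le_one[of \<rho> m] by (auto simp: m mult_le_cancel_right1)
  have const: "p (Suc i) = p i" if "j < i" for i
  proof -
    have "\<exists>l<i. norm (p l - p (Suc l)) \<le> 0"
      using that j(1) by (intro exI[of _ j]) simp
    then show ?thesis
      using pgm[unfolded pgm_sequence_def, THEN conjunct2, THEN spec, of i] by (simp only: if_P)
  qed
  have "p i = p j" if "j \<le> i" for i
    using that
  proof (induction i rule: dec_induct)
    case (step i)
    then show ?case
      using const[of i] j(1) by (cases "i = j") auto
  qed simp
  from this[of k] this[of "Suc k"] have pk: "p k = p j" "p (Suc k) = p j"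
    using \<open>j < k\<close> by simp_all
  \<comment> \<open>A point fixed by the projected step of size \<open>a\<close> is then fixed for
    the larger \<open>\<alpha>\<close> too.\<close>
  have "a * norm (trial_point A (p j) \<alpha> - p j) \<le> \<alpha> * norm (trial_point A (p j) a - p j)"
    unfolding trial_point_def
    by (rule projected_step_ratio[OF convex_std_simplex compact_imp_closed[OF compact_std_simplex] _ \<open>0 < a\<close> \<open>a \<le> \<alpha>\<close>])
      (use in_S in auto)
  then have fixed: "trial_point A (p j) \<alpha> = p j"
    using a(2) \<open>0 < a\<close> by (simp add: mult_le_0_iff)
  moreover have "armijo_cond A \<sigma> (p j) \<alpha>"
    using m(2) fixed a(2) by (simp add: armijo_cond_def)
  then have "armijo_step A \<sigma> \<rho> \<alpha> (p j) \<alpha>"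
    unfolding armijo_step_def by (intro exI[of _ 0]) simp
  ultimately show ?thesis
    by (auto simp: pk)
qed

theorem theorem6:
  fixes A :: "real^'n^'n" and \<sigma> \<rho> \<alpha> :: real and p :: "nat \<Rightarrow> real^'n"
  assumes "stable_matrix A"
    and "0 < \<sigma>" and "\<sigma> < 1"
    and "0 < \<rho>" and "\<rho> < 1"
    and "0 < \<alpha>"
    and "pgm_sequence A \<sigma> \<rho> \<alpha> 0 p"
  shows "\<exists>p_opt. is_arg_min (objective A) (\<lambda>q. q \<in> feasible_set A) p_opt
           \<and> (\<forall>q. is_arg_min (objective A) (\<lambda>q. q \<in> feasible_set A) q \<longrightarrow> q = p_opt)
           \<and> p \<longlonglongrightarrow> p_opt"
proof -
  define S :: "(real^'n) set" where "S = std_simplex"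
  define X where "X = {p. 0 < det (W_con A p)}"
  define f where "f = objective A"
  define g where "g = gradient (objective A)"
  have det_cont: "continuous_on U (\<lambda>p. det (W_con A p))" for U
    by (rule has_continuous_gradient_imp_continuous[OF has_continuous_gradient_det_W_con])
  have SX: "S \<inter> X_set A = S \<inter> X"
    unfolding S_def X_def by (rule std_simplex_Int_X_set[OF assms(1)])
  then have feasible: "feasible_set A = S \<inter> X"
    by (simp add: feasible_set_def S_def Int_commute)
  have S: "compact S" "convex S" "closed S"
    by (simp_all add: S_def compact_std_simplex convex_std_simplex compact_imp_closed)
  have X: "open X"
    unfolding X_def by (intro open_Collect_less continuous_on_const det_cont)
  have f: "continuous_on (S \<inter> X) f" and g: "continuous_on (S \<inter> X) g"
  proof -
    show "continuous_on (S \<inter> X) f"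
      unfolding f_def objective_def[abs_def] X_def by (intro continuous_intros det_cont) auto
    show "continuous_on (S \<inter> X) g"
      unfolding g_def X_def by (rule continuous_on_subset[OF objective_gradient(2)]) auto
  qed
  have grad: "f x + g x \<bullet> (y - x) < f y" if "x \<in> S \<inter> X" "y \<in> S \<inter> X" "x \<noteq> y" for x y
    using objective_strict_gradient_inequality[OF assms(1) _ _ that(3)] that(1,2)
    unfolding f_def g_def SX[symmetric] by blast
  have p0: "p 0 = (\<chi> i. 1 / real CARD('n))"
    using assms(7) by (simp add: pgm_sequence_def)
  then have "p 0 \<in> S" "pos_def (W_con A (p 0))"
    by (auto simp: S_def std_simplex_def intro!: W_con_pos_def[OF assms(1)])
  then have x0: "p 0 \<in> S \<inter> X"
    by (simp add: X_def pos_def_det_pos)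
  \<comment> \<open>Since the determinant at \<open>p 0\<close> is positive, the lower bound on the
    determinant already implies membership in \<open>X\<close>; only a non-strict inequality between
    continuous functions remains.\<close>
  have "{y \<in> S \<inter> X. f y \<le> f (p 0)} = S \<inter> {y. det (W_con A (p 0)) \<le> det (W_con A y)}"
    using x0 by (auto simp: f_def objective_def X_def)
  then have level: "closed {y \<in> S \<inter> X. f y \<le> f (p 0)}"
    using S(3) by (simp add: closed_Int closed_Collect_le det_cont)
  have trial: "trial_point A x a = closest_point S (x - a *\<^sub>R g x)" for x a
    by (simp add: trial_point_def S_def g_def)
  have trial_S: "closest_point S y \<in> S" for y
    using S(3) x0 by (intro closest_point_in_set) auto
  have cond: "armijo_cond A \<sigma> x a \<longleftrightarrow> closest_point S (x - a *\<^sub>R g x) \<in> X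
      \<and> f (closest_point S (x - a *\<^sub>R g x)) \<le> f x + \<sigma> * (g x \<bullet> (closest_point S (x - a *\<^sub>R g x) - x))" for x a
    using SX trial_S unfolding armijo_cond_def trial g_def[symmetric] unfolding f_def[symmetric] by blast
  obtain q where q: "q \<in> S \<inter> X" "\<And>y. y \<in> S \<inter> X \<Longrightarrow> f q \<le> f y" "p \<longlonglongrightarrow> q"
  proof (rule projected_gradient_armijo_converges[where f = f and g = g and x = p, OF S(1,2) X f g grad assms(2-6) x0 level])
    fix k
    show "\<exists>m. p (Suc k) = closest_point S (p k - (\<rho> ^ m * \<alpha>) *\<^sub>R g (p k)) \<and>
        (closest_point S (p k - (\<rho> ^ m * \<alpha>) *\<^sub>R g (p k)) \<in> X \<and>
         f (closest_point S (p k - (\<rho> ^ m * \<alpha>) *\<^sub>R g (p k)))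
           \<le> f (p k) + \<sigma> * (g (p k) \<bullet> (closest_point S (p k - (\<rho> ^ m * \<alpha>) *\<^sub>R g (p k)) - p k))) \<and>
        (\<forall>j<m. \<not> (closest_point S (p k - (\<rho> ^ j * \<alpha>) *\<^sub>R g (p k)) \<in> X \<and>
           f (closest_point S (p k - (\<rho> ^ j * \<alpha>) *\<^sub>R g (p k)))
             \<le> f (p k) + \<sigma> * (g (p k) \<bullet> (closest_point S (p k - (\<rho> ^ j * \<alpha>) *\<^sub>R g (p k)) - p k))))"
      using pgm_sequence_step[OF assms(7,4-6) \<open>p 0 \<in> S\<close>[unfolded S_def], of k]
      unfolding armijo_step_def cond trial by blast
  qed (use that in blast)+
  show ?thesis
  proof (intro exI conjI allI impI)
    show "is_arg_min (objective A) (\<lambda>q. q \<in> feasible_set A) q"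
      using q by (auto simp: is_arg_min_def feasible f_def not_less)
    show "p \<longlonglongrightarrow> q"
      by (rule q(3))
    fix r assume "is_arg_min (objective A) (\<lambda>q. q \<in> feasible_set A) r"
    then have "r \<in> S \<inter> X" "f r \<le> f q"
      using q(1) by (auto simp: is_arg_min_def feasible f_def not_less)
    then show "r = q"
      by (intro unique_minimiser_of_strict_gradient_inequality[where f = f and g = g, OF S(2) X grad q(1,2)])
  qed
qed

end
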